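(* Let $s\ge1$. Let $M$ be a (smooth) manifold with no boundary equipped with a measure $\mu$ and let $\mathbf X=\{X_1,\dots,X_r\}$ be a Hörmander system on $M$ with associated sub-Laplacian $\mathcal L=-\sum_{j=1}^rX_j^2$. Assume that the Sobolev embedding holds with respect to the measure $\mu$ and the Hörmander system $\mathbf X$, i.e. there is some $m$ such that $\|f\|_{L^\infty}\lesssim\sum_{|\alpha|\le m}\|X^\alpha f\|_{L^2}$. Assume also that $\mathcal L$ is a non-negative essentially self-adjoint operator on $L^2(M)$. Then $$\gamma^s_{\mathbf X,L^2}(M)\subset\big\{\phi\in\mathcal C^\infty(M)\,:\,\exists D>0\text{ such that }\|e^{D\mathcal L^{\frac1{2s}}}\phi\|_{L^2(M)}<\infty\big\}.$$
   Context: A Hörmander system $\mathbf X=\{X_1,\dots,X_r\}$ on $M$ is a family of real smooth vector fields such that at every $x\in M$ the real Lie algebra generated by $\mathbf X$ (the $X_j$ and their iterated commutators) spans the whole tangent space $T_xM$. For $\alpha\in\mathbb N_0^r$, $\partial^\alpha$ (also written $X^\alpha$) denotes any product $Y_1\cdots Y_{|\alpha|}$ with each $Y_j\in\{X_1,\dots,X_r\}$ and such that each $X_k$ occurs exactly $\alpha_k$ times, $k=1,\dots,r$. For $s\ge1$, $\gamma^s_{\mathbf X,L^2}(M)$ is the space of all $\phi\in\mathcal C^\infty(M)$ for which there exist $A,C>0$ such that for every $\alpha\in\mathbb N_0^r$ one has $\|\partial^\alpha\phi\|_{L^2(M)}\le CA^{|\alpha|}(\alpha!)^s$. The operator $\mathcal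 L$ is regarded as a differential operator defined on smooth functions; its self-adjoint extension on $L^2(M)=L^2(M,\mu)$ is still denoted $\mathcal L$, functions of $\mathcal L$ are defined by the spectral theorem, and $\|e^{D\mathcal L^{1/(2s)}}\phi\|_{L^2}<\infty$ means $\phi\in\mathrm{Dom}(e^{D\mathcal L^{1/(2s)}})$. *)

theory Defs
  imports "HOL-Analysis.Analysis" "HOL-Probability.Essential_Supremum"
begin

section \<open>Smooth manifolds and smooth functions\<close>

text \<open>Meant for open \<open>S\<close>; the domain is finite-dimensional, so continuity of all
  iterated directional derivatives of order up to \<open>k\<close> is the usual class \<open>C\<^sup>k\<close>.\<close>

primrec Ck_on :: "nat \<Rightarrow> 'b::euclidean_space set \<Rightarrow> ('b \<Rightarrow> 'c::real_normed_vector) \<Rightarrow> bool" where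
  "Ck_on 0 S f \<longleftrightarrow> continuous_on S f"
| "Ck_on (Suc k) S f \<longleftrightarrow>
     (\<forall>x\<in>S. f differentiable (at x)) \<and> (\<forall>v. Ck_on k S (\<lambda>x. frechet_derivative f (at x) v))"

definition smooth_on :: "'b::euclidean_space set \<Rightarrow> ('b \<Rightarrow> 'c::real_normed_vector) \<Rightarrow> bool" where
  "smooth_on S f \<longleftrightarrow> (\<forall>k. Ck_on k S f)"

text \<open>The manifold is the whole type \<open>'a\<close>. A chart is a pair of its domain and its coordinate
  map, whose values matter only on the domain. Charts have open images in a Euclidean space, so
  there is no boundary.\<close>

type_synonym ('a, 'b) atlas = "('a set \<times> ('a \<Rightarrow> 'b)) set"

definition smooth_atlas ::
    "('a::{t2_space, second_countable_topology}, 'b::euclidean_space) atlas \<Rightarrow> bool" where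
  "smooth_atlas \<A> \<longleftrightarrow>
     (\<Union>(U, c)\<in>\<A>. U) = UNIV \<and>
     (\<forall>(U, c)\<in>\<A>. open U \<and> open (c ` U) \<and> homeomorphism U (c ` U) c (inv_into U c)) \<and>
     (\<forall>(U, c)\<in>\<A>. \<forall>(V, d)\<in>\<A>. smooth_on (c ` (U \<inter> V)) (d \<circ> inv_into U c))"

definition C_inf :: "('a, 'b::euclidean_space) atlas \<Rightarrow> ('a \<Rightarrow> 'c::real_normed_vector) set" where
  "C_inf \<A> = {f. \<forall>(U, c)\<in>\<A>. smooth_on (c ` U) (f \<circ> inv_into U c)}"


section \<open>Vector fields and Hoermander systems\<close>

text \<open>Real smooth vector fields are the derivations of the algebra of real-valued smooth
  functions, and tangent vectors at \<open>x\<close> are the derivations at \<open>x\<close>. Only the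
  values on smooth functions matter.\<close>

type_synonym 'a operator = "('a \<Rightarrow> real) \<Rightarrow> ('a \<Rightarrow> real)"

definition vector_field :: "('a, 'b::euclidean_space) atlas \<Rightarrow> 'a operator \<Rightarrow> bool" where
  "vector_field \<A> X \<longleftrightarrow>
     (\<forall>f\<in>C_inf \<A>. X f \<in> C_inf \<A>) \<and>
     (\<forall>f\<in>C_inf \<A>. \<forall>g\<in>C_inf \<A>. X (\<lambda>x. f x + g x) = (\<lambda>x. X f x + X g x)) \<and>
     (\<forall>a. \<forall>f\<in>C_inf \<A>. X (\<lambda>x. a * f x) = (\<lambda>x. a * X f x)) \<and>
     (\<forall>f\<in>C_inf \<A>. \<forall>g\<in>C_inf \<A>. X (\<lambda>x. f x * g x) = (\<lambda>x. f x * X g x + g x * X f x))"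

definition tangent_vector ::
    "('a, 'b::euclidean_space) atlas \<Rightarrow> 'a \<Rightarrow> (('a \<Rightarrow> real) \<Rightarrow> real) \<Rightarrow> bool" where
  "tangent_vector \<A> p v \<longleftrightarrow>
     (\<forall>f\<in>C_inf \<A>. \<forall>g\<in>C_inf \<A>. v (\<lambda>x. f x + g x) = v f + v g) \<and>
     (\<forall>a. \<forall>f\<in>C_inf \<A>. v (\<lambda>x. a * f x) = a * v f) \<and>
     (\<forall>f\<in>C_inf \<A>. \<forall>g\<in>C_inf \<A>. v (\<lambda>x. f x * g x) = f p * v g + g p * v f)"

inductive_set lie_algebra_generated :: "'a operator set \<Rightarrow> 'a operator set"
  for S :: "'a operator set" where
  generator: "X \<in> S \<Longrightarrow> X \<in> lie_algebra_generated S"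
| zero: "(\<lambda>f x. 0) \<in> lie_algebra_generated S"
| add: "\<lbrakk>X \<in> lie_algebra_generated S; Y \<in> lie_algebra_generated S\<rbrakk>
         \<Longrightarrow> (\<lambda>f x. X f x + Y f x) \<in> lie_algebra_generated S"
| scale: "X \<in> lie_algebra_generated S \<Longrightarrow> (\<lambda>f x. a * X f x) \<in> lie_algebra_generated S"
| commutator: "\<lbrakk>X \<in> lie_algebra_generated S; Y \<in> lie_algebra_generated S\<rbrakk>
         \<Longrightarrow> (\<lambda>f x. X (Y f) x - Y (X f) x) \<in> lie_algebra_generated S"

definition hormander_system ::
    "('a, 'b::euclidean_space) atlas \<Rightarrow> nat \<Rightarrow> (nat \<Rightarrow> 'a operator) \<Rightarrow> bool" where
  "hormander_system \<A> r X \<longleftrightarrow>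
     (\<forall>j\<in>{1..r}. vector_field \<A> (X j)) \<and>
     (\<forall>p v. tangent_vector \<A> p v \<longrightarrow>
        (\<exists>Y\<in>lie_algebra_generated (X ` {1..r}). \<forall>f\<in>C_inf \<A>. v f = Y f p))"

text \<open>Functions on the manifold are complex-valued from here on; a real vector field acts on
  real and imaginary parts.\<close>

definition cact :: "'a operator \<Rightarrow> ('a \<Rightarrow> complex) \<Rightarrow> ('a \<Rightarrow> complex)" where
  "cact X f = (\<lambda>x. Complex (X (\<lambda>y. Re (f y)) x) (X (\<lambda>y. Im (f y)) x))"

definition sub_laplacian ::
    "nat \<Rightarrow> (nat \<Rightarrow> 'a operator) \<Rightarrow> ('a \<Rightarrow> complex) \<Rightarrow> ('a \<Rightarrow> complex)" where
  "sub_laplacian r X f = (\<lambda>x. - (\<Sum>j=1..r. cact (X j) (cact (X j) f) x))"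

text \<open>A word \<open>[k\<^sub>1, \<dots>, k\<^sub>n]\<close> stands for the product
  \<open>X\<^bsub>k\<^sub>1\<^esub> \<cdots> X\<^bsub>k\<^sub>n\<^esub>\<close>.\<close>

definition word_op ::
    "(nat \<Rightarrow> 'a operator) \<Rightarrow> nat list \<Rightarrow> ('a \<Rightarrow> complex) \<Rightarrow> ('a \<Rightarrow> complex)" where
  "word_op X w f = foldr (\<lambda>k. cact (X k)) w f"

text \<open>The admissible orderings for the multi-index \<open>\<alpha>\<close>, of which only the entries
  \<open>\<alpha> 1, \<dots>, \<alpha> r\<close> matter.\<close>

definition words :: "nat \<Rightarrow> (nat \<Rightarrow> nat) \<Rightarrow> nat list set" where
  "words r \<alpha> = {w. set w \<subseteq> {1..r} \<and> (\<forall>k\<in>{1..r}. count_list w k = \<alpha> k)}"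


section \<open>Square-integrable functions\<close>

text \<open>Elements of \<open>L\<^sup>2\<close> are represented by functions, without passing to classes
  modulo null sets.\<close>

definition L2 :: "'a measure \<Rightarrow> ('a \<Rightarrow> complex) set" where
  "L2 \<mu> = {f \<in> borel_measurable \<mu>. integrable \<mu> (\<lambda>x. (cmod (f x))\<^sup>2)}"

definition L2_norm :: "'a measure \<Rightarrow> ('a \<Rightarrow> complex) \<Rightarrow> real" where
  "L2_norm \<mu> f = sqrt (LINT x|\<mu>. (cmod (f x))\<^sup>2)"

definition L2_inner :: "'a measure \<Rightarrow> ('a \<Rightarrow> complex) \<Rightarrow> ('a \<Rightarrow> complex) \<Rightarrow> complex" where
  "L2_inner \<mu> f g = (LINT x|\<mu>. f x * cnj (g x))"

definition gevrey_class ::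
    "('a, 'b::euclidean_space) atlas \<Rightarrow> 'a measure \<Rightarrow> nat \<Rightarrow> (nat \<Rightarrow> 'a operator) \<Rightarrow> real
      \<Rightarrow> ('a \<Rightarrow> complex) set" where
  "gevrey_class \<A> \<mu> r X s =
     {\<phi> \<in> C_inf \<A>. \<exists>A>0. \<exists>C>0. \<forall>\<alpha>. \<forall>w\<in>words r \<alpha>.
        word_op X w \<phi> \<in> L2 \<mu> \<and>
        L2_norm \<mu> (word_op X w \<phi>)
          \<le> C * A ^ (\<Sum>k=1..r. \<alpha> k) * (\<Prod>k=1..r. fact (\<alpha> k)) powr s}"

text \<open>The right-hand side runs over all products of at most \<open>m\<close> of the vector fields;
  when one of them is not in \<open>L\<^sup>2\<close> it is infinite and there is nothing to require.\<close>

definition sobolev_embedding ::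
    "('a, 'b::euclidean_space) atlas \<Rightarrow> 'a measure \<Rightarrow> nat \<Rightarrow> (nat \<Rightarrow> 'a operator) \<Rightarrow> bool" where
  "sobolev_embedding \<A> \<mu> r X \<longleftrightarrow>
     (\<exists>m. \<exists>C>0. \<forall>f\<in>C_inf \<A>.
        (\<forall>w. set w \<subseteq> {1..r} \<and> length w \<le> m \<longrightarrow> word_op X w f \<in> L2 \<mu>) \<longrightarrow>
        esssup \<mu> (\<lambda>x. ereal (cmod (f x)))
          \<le> ereal (C * (\<Sum>w | set w \<subseteq> {1..r} \<and> length w \<le> m. L2_norm \<mu> (word_op X w f))))"


section \<open>Unbounded operators\<close>

text \<open>Operators are represented by their graphs.\<close>

type_synonym 'a graph = "(('a \<Rightarrow> complex) \<times> ('a \<Rightarrow> complex)) set"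

definition densely_defined :: "'a measure \<Rightarrow> 'a graph \<Rightarrow> bool" where
  "densely_defined \<mu> T \<longleftrightarrow>
     (\<forall>f\<in>L2 \<mu>. \<forall>\<epsilon>>0. \<exists>u\<in>Domain T. L2_norm \<mu> (\<lambda>x. f x - u x) < \<epsilon>)"

definition graph_closure :: "'a measure \<Rightarrow> 'a graph \<Rightarrow> 'a graph" where
  "graph_closure \<mu> T = {(f, g). f \<in> L2 \<mu> \<and> g \<in> L2 \<mu> \<and>
     (\<forall>\<epsilon>>0. \<exists>(u, v)\<in>T. L2_norm \<mu> (\<lambda>x. f x - u x) < \<epsilon> \<and> L2_norm \<mu> (\<lambda>x. g x - v x) < \<epsilon>)}"

definition graph_adjoint :: "'a measure \<Rightarrow> 'a graph \<Rightarrow> 'a graph" where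
  "graph_adjoint \<mu> T = {(f, g). f \<in> L2 \<mu> \<and> g \<in> L2 \<mu> \<and>
     (\<forall>(u, v)\<in>T. L2_inner \<mu> v f = L2_inner \<mu> u g)}"

definition self_adjoint :: "'a measure \<Rightarrow> 'a graph \<Rightarrow> bool" where
  "self_adjoint \<mu> T \<longleftrightarrow> densely_defined \<mu> T \<and> graph_adjoint \<mu> T = T"

text \<open>Density makes the adjoint of the closure single-valued modulo null sets, so the operator is
  then automatically well defined modulo null sets, symmetric and closable.\<close>

definition essentially_self_adjoint :: "'a measure \<Rightarrow> 'a graph \<Rightarrow> bool" where
  "essentially_self_adjoint \<mu> T \<longleftrightarrow> densely_defined \<mu> T \<and> self_adjoint \<mu> (graph_closure \<mu> T)"

definition nonneg_operator :: "'a measure \<Rightarrow> 'a graph \<Rightarrow> bool" where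
  "nonneg_operator \<mu> T \<longleftrightarrow>
     (\<forall>(u, v)\<in>T. Im (L2_inner \<mu> v u) = 0 \<and> 0 \<le> Re (L2_inner \<mu> v u))"

text \<open>The differential operator on its natural domain of smooth functions. If the compactly
  supported smooth functions lie in \<open>L\<^sup>2\<close> and the operator is essentially self-adjoint on
  them, a cut-off argument shows that it is so on this domain too, with the same closure.\<close>

definition sub_laplacian_L2 ::
    "('a, 'b::euclidean_space) atlas \<Rightarrow> 'a measure \<Rightarrow> nat \<Rightarrow> (nat \<Rightarrow> 'a operator) \<Rightarrow> 'a graph" where
  "sub_laplacian_L2 \<A> \<mu> r X =
     {(f, sub_laplacian r X f) | f. f \<in> C_inf \<A> \<and> f \<in> L2 \<mu> \<and> sub_laplacian r X f \<in> L2 \<mu>}"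


section \<open>Functional calculus\<close>

definition orthogonal_projection ::
    "'a measure \<Rightarrow> (('a \<Rightarrow> complex) \<Rightarrow> ('a \<Rightarrow> complex)) \<Rightarrow> bool" where
  "orthogonal_projection \<mu> P \<longleftrightarrow>
     (\<forall>f\<in>L2 \<mu>. P f \<in> L2 \<mu>) \<and>
     (\<forall>f\<in>L2 \<mu>. \<forall>g\<in>L2 \<mu>. \<forall>a b. AE x in \<mu>. P (\<lambda>y. a * f y + b * g y) x = a * P f x + b * P g x) \<and>
     (\<forall>f\<in>L2 \<mu>. AE x in \<mu>. P (P f) x = P f x) \<and>
     (\<forall>f\<in>L2 \<mu>. \<forall>g\<in>L2 \<mu>. L2_inner \<mu> (P f) g = L2_inner \<mu> f (P g))"

definition projection_valued_measure ::
    "'a measure \<Rightarrow> (real set \<Rightarrow> ('a \<Rightarrow> complex) \<Rightarrow> ('a \<Rightarrow> complex)) \<Rightarrow> bool" where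
  "projection_valued_measure \<mu> E \<longleftrightarrow>
     (\<forall>B\<in>sets borel. orthogonal_projection \<mu> (E B)) \<and>
     (\<forall>f\<in>L2 \<mu>. AE x in \<mu>. E {} f x = 0) \<and>
     (\<forall>f\<in>L2 \<mu>. AE x in \<mu>. E UNIV f x = f x) \<and>
     (\<forall>B\<in>sets borel. \<forall>B'\<in>sets borel. \<forall>f\<in>L2 \<mu>. AE x in \<mu>. E (B \<inter> B') f x = E B (E B' f) x) \<and>
     (\<forall>B :: nat \<Rightarrow> real set. range B \<subseteq> sets borel \<and> disjoint_family B \<longrightarrow>
        (\<forall>f\<in>L2 \<mu>. (\<lambda>n. L2_norm \<mu> (\<lambda>x. E (\<Union>i. B i) f x - (\<Sum>i<n. E (B i) f x)))
                    \<longlonglongrightarrow> 0))"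

text \<open>The measure \<open>B \<mapsto> \<langle>E(B)f, f\<rangle>\<close>.\<close>

definition spectral_measure ::
    "'a measure \<Rightarrow> (real set \<Rightarrow> ('a \<Rightarrow> complex) \<Rightarrow> ('a \<Rightarrow> complex)) \<Rightarrow> ('a \<Rightarrow> complex)
      \<Rightarrow> real measure" where
  "spectral_measure \<mu> E f =
     measure_of UNIV (sets borel) (\<lambda>B. ennreal (Re (L2_inner \<mu> (E B f) f)))"

text \<open>The domain of \<open>\<integral>F dE\<close>: there the squared norm of its value at \<open>f\<close> is the
  integral below, which is infinite for all other \<open>f\<close>.\<close>

definition spectral_domain ::
    "'a measure \<Rightarrow> (real set \<Rightarrow> ('a \<Rightarrow> complex) \<Rightarrow> ('a \<Rightarrow> complex)) \<Rightarrow> (real \<Rightarrow> real)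
      \<Rightarrow> ('a \<Rightarrow> complex) set" where
  "spectral_domain \<mu> E F =
     {f \<in> L2 \<mu>. (\<integral>\<^sup>+ t. ennreal ((F t)\<^sup>2) \<partial>spectral_measure \<mu> E f) < \<infinity>}"

text \<open>The operator \<open>\<integral>F dE\<close>, given by
  \<open>\<langle>(\<integral>F dE)f, h\<rangle> = \<integral>F d\<langle>Ef, h\<rangle>\<close>; the integral against the
  complex measure \<open>\<langle>Ef, h\<rangle>\<close> is expanded by polarization.\<close>

definition spectral_integral ::
    "'a measure \<Rightarrow> (real set \<Rightarrow> ('a \<Rightarrow> complex) \<Rightarrow> ('a \<Rightarrow> complex)) \<Rightarrow> (real \<Rightarrow> real)
      \<Rightarrow> 'a graph" where
  "spectral_integral \<mu> E F =
     {(f, g). f \<in> spectral_domain \<mu> E F \<and> g \<in> L2 \<mu> \<and>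
       (\<forall>h\<in>spectral_domain \<mu> E F.
          L2_inner \<mu> g h =
            (\<Sum>k<4. \<i> ^ k * of_real (LINT t|spectral_measure \<mu> E (\<lambda>x. f x + \<i> ^ k * h x). F t)) / 4)}"

text \<open>The spectral theorem provides exactly one such \<open>E\<close> (modulo null sets) for every
  self-adjoint \<open>T\<close>, and \<open>F(T)\<close> is then \<open>\<integral>F dE\<close>.\<close>

definition spectral_resolution ::
    "'a measure \<Rightarrow> 'a graph \<Rightarrow> (real set \<Rightarrow> ('a \<Rightarrow> complex) \<Rightarrow> ('a \<Rightarrow> complex)) \<Rightarrow> bool" where
  "spectral_resolution \<mu> T E \<longleftrightarrow>
     projection_valued_measure \<mu> E \<and> T = spectral_integral \<mu> E (\<lambda>t. t)"

end

theory Submission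
  imports Defs
begin

text \<open>Every \<open>\<L>\<^sup>k\<phi>\<close> is, up to sign, a sum of \<open>r\<^sup>k\<close> products of \<open>2k\<close> vector fields applied to \<open>\<phi>\<close>, so
  the Gevrey bounds give \<open>\<parallel>\<L>\<^sup>k\<phi>\<parallel> \<le> C R\<^sup>k (2k)!\<^sup>s\<close>. On a spectral subspace on which \<open>\<bar>t\<bar> \<ge> a\<close> and
  \<open>t\<close> has constant sign, the operator is bounded below by \<open>a\<close>. Hence the spectral measure of \<open>\<phi>\<close>
  gives \<open>{\<bar>t\<bar> \<ge> a}\<close> mass at most \<open>2 a\<^bsup>-2k\<^esup> \<parallel>\<L>\<^sup>k\<phi>\<parallel>\<^sup>2\<close>; optimizing in \<open>k\<close>, this decays like
  \<open>exp (-c a\<^bsup>1/(2s)\<^esup>)\<close>, which makes \<open>exp (2D t\<^bsup>1/(2s)\<^esup>)\<close> integrable for small \<open>D\<close>.\<close>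

section \<open>Square-integrable functions\<close>

lemma L2_lincomb:
  assumes "f \<in> L2 \<mu>" "g \<in> L2 \<mu>"
  shows "(\<lambda>x. a * f x + b * g x) \<in> L2 \<mu>"
proof -
  have meas [measurable]: "f \<in> borel_measurable \<mu>" "g \<in> borel_measurable \<mu>"
    using assms by (auto simp: L2_def)
  have int: "integrable \<mu> (\<lambda>x. 2 * (cmod a)\<^sup>2 * (cmod (f x))\<^sup>2 + 2 * (cmod b)\<^sup>2 * (cmod (g x))\<^sup>2)"
    using assms by (auto simp: L2_def)
  have bound: "(cmod (a * f x + b * g x))\<^sup>2
      \<le> 2 * (cmod a)\<^sup>2 * (cmod (f x))\<^sup>2 + 2 * (cmod b)\<^sup>2 * (cmod (g x))\<^sup>2" for x
  proof -
    have "(cmod (a * f x + b * g x))\<^sup>2 \<le> (cmod (a * f x) + cmod (b * g x))\<^sup>2"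
      by (intro power_mono norm_triangle_ineq norm_ge_zero)
    also have "\<dots> \<le> 2 * (cmod (a * f x))\<^sup>2 + 2 * (cmod (b * g x))\<^sup>2"
      using zero_le_power2[of "cmod (a * f x) - cmod (b * g x)"]
      by (simp add: power2_sum power2_diff)
    finally show ?thesis by (simp add: norm_mult power_mult_distrib)
  qed
  show ?thesis
    unfolding L2_def
    by (auto intro!: Bochner_Integration.integrable_bound[OF int] order_trans[OF bound])
qed

lemma L2_add: "f \<in> L2 \<mu> \<Longrightarrow> g \<in> L2 \<mu> \<Longrightarrow> (\<lambda>x. f x + g x) \<in> L2 \<mu>"
  using L2_lincomb[of f \<mu> g 1 1] by simp

lemma L2_diff: "f \<in> L2 \<mu> \<Longrightarrow> g \<in> L2 \<mu> \<Longrightarrow> (\<lambda>x. f x - g x) \<in> L2 \<mu>"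
  using L2_lincomb[of f \<mu> g 1 "-1"] by simp

lemma L2_uminus: "f \<in> L2 \<mu> \<Longrightarrow> (\<lambda>x. - f x) \<in> L2 \<mu>"
  using L2_lincomb[of f \<mu> f "-1" 0] by simp

lemma L2_zero: "(\<lambda>x. 0) \<in> L2 \<mu>"
  by (simp add: L2_def)

lemma L2_sum: "(\<And>i. i \<in> I \<Longrightarrow> f i \<in> L2 \<mu>) \<Longrightarrow> (\<lambda>x. \<Sum>i\<in>I. f i x) \<in> L2 \<mu>"
  by (induction I rule: infinite_finite_induct) (auto intro: L2_zero L2_add)

section \<open>Inner product, norm and the Cauchy-Schwarz inequality\<close>

lemma L2_inner_integrable:
  assumes "f \<in> L2 \<mu>" "g \<in> L2 \<mu>"
  shows "integrable \<mu> (\<lambda>x. f x * cnj (g x))"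
proof -
  have meas [measurable]: "f \<in> borel_measurable \<mu>" "g \<in> borel_measurable \<mu>"
    using assms by (auto simp: L2_def)
  have int: "integrable \<mu> (\<lambda>x. (cmod (f x))\<^sup>2 + (cmod (g x))\<^sup>2)"
    using assms by (auto simp: L2_def)
  have bound: "cmod (f x) * cmod (g x) \<le> (cmod (f x))\<^sup>2 + (cmod (g x))\<^sup>2" for x
    using zero_le_power2[of "cmod (f x) - cmod (g x)"] zero_le_power2[of "cmod (f x)"]
      zero_le_power2[of "cmod (g x)"] unfolding power2_diff by linarith
  have cnj_meas: "(\<lambda>x. cnj (g x)) \<in> borel_measurable \<mu>"
    by (rule measurable_compose[OF meas(2)])
       (intro borel_measurable_continuous_onI continuous_intros)
  show ?thesis
    by (rule Bochner_Integration.integrable_bound[OF int])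
       (use bound cnj_meas in \<open>auto simp: norm_mult\<close>)
qed

lemma L2_inner_lincomb_left:
  assumes "f \<in> L2 \<mu>" "g \<in> L2 \<mu>" "h \<in> L2 \<mu>"
  shows "L2_inner \<mu> (\<lambda>x. a * f x + b * g x) h = a * L2_inner \<mu> f h + b * L2_inner \<mu> g h"
  using L2_inner_integrable[OF assms(1,3)] L2_inner_integrable[OF assms(2,3)]
  by (simp add: L2_inner_def distrib_right mult.assoc)

lemma L2_inner_diff_left:
  assumes "f \<in> L2 \<mu>" "g \<in> L2 \<mu>" "h \<in> L2 \<mu>"
  shows "L2_inner \<mu> (\<lambda>x. f x - g x) h = L2_inner \<mu> f h - L2_inner \<mu> g h"
  using L2_inner_lincomb_left[OF assms, of 1 "-1"] by simp

lemma L2_inner_sum_left: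
  assumes "\<And>i. i \<in> I \<Longrightarrow> f i \<in> L2 \<mu>" "h \<in> L2 \<mu>"
  shows "L2_inner \<mu> (\<lambda>x. \<Sum>i\<in>I. f i x) h = (\<Sum>i\<in>I. L2_inner \<mu> (f i) h)"
  using L2_inner_integrable[OF assms(1) assms(2)]
  by (simp add: L2_inner_def sum_distrib_right)

lemma L2_inner_commute: "L2_inner \<mu> g f = cnj (L2_inner \<mu> f g)"
proof -
  have "cnj (L2_inner \<mu> f g) = (LINT x|\<mu>. cnj (f x * cnj (g x)))"
    unfolding L2_inner_def by (rule Bochner_Integration.integral_cnj[symmetric])
  then show ?thesis by (simp add: L2_inner_def mult.commute)
qed

lemma L2_inner_lincomb_right:
  assumes "f \<in> L2 \<mu>" "g \<in> L2 \<mu>" "h \<in> L2 \<mu>"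
  shows "L2_inner \<mu> h (\<lambda>x. a * f x + b * g x)
    = cnj a * L2_inner \<mu> h f + cnj b * L2_inner \<mu> h g"
  by (subst (1 2 3) L2_inner_commute) (simp add: L2_inner_lincomb_left assms)

text \<open>Linearity and multiplicativity of a projection-valued measure hold only almost
  everywhere; this turns them into exact identities between inner products.\<close>

lemma L2_inner_cong_AE:
  assumes "f \<in> L2 \<mu>" "f' \<in> L2 \<mu>" "g \<in> L2 \<mu>" "g' \<in> L2 \<mu>"
    and "AE x in \<mu>. f x = f' x" "AE x in \<mu>. g x = g' x"
  shows "L2_inner \<mu> f g = L2_inner \<mu> f' g'"
  unfolding L2_inner_def
proof (rule integral_cong_AE)
  show "AE x in \<mu>. f x * cnj (g x) = f' x * cnj (g' x)"
    using assms(5,6) by eventually_elim simp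
qed (use L2_inner_integrable[OF assms(1,3)] L2_inner_integrable[OF assms(2,4)] in auto)

lemma L2_norm_nonneg: "0 \<le> L2_norm \<mu> f"
  by (simp add: L2_norm_def)

lemma L2_norm_power2: "(L2_norm \<mu> f)\<^sup>2 = (LINT x|\<mu>. (cmod (f x))\<^sup>2)"
  by (simp add: L2_norm_def)

lemma L2_inner_self: "L2_inner \<mu> f f = of_real ((L2_norm \<mu> f)\<^sup>2)"
  unfolding L2_inner_def L2_norm_power2 complex_norm_square[symmetric]
  by (simp flip: of_real_power)

lemma L2_norm_uminus: "L2_norm \<mu> (\<lambda>x. - f x) = L2_norm \<mu> f"
  by (simp add: L2_norm_def)

text \<open>The discriminant argument for the nonnegative quadratic t -> integral of (t|f| - |g|)^2.
  It is run on the moduli, so that \<open>b\<close> is real and dominates the modulus of the inner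
  product.\<close>

lemma L2_cauchy_schwarz:
  assumes f: "f \<in> L2 \<mu>" and g: "g \<in> L2 \<mu>"
  shows "cmod (L2_inner \<mu> f g) \<le> L2_norm \<mu> f * L2_norm \<mu> g"
proof -
  define b where "b = (LINT x|\<mu>. cmod (f x) * cmod (g x))"
  have int: "integrable \<mu> (\<lambda>x. cmod (f x) * cmod (g x))"
    using integrable_norm[OF L2_inner_integrable[OF f g]] by (simp add: norm_mult)
  have ints: "integrable \<mu> (\<lambda>x. (cmod (f x))\<^sup>2)" "integrable \<mu> (\<lambda>x. (cmod (g x))\<^sup>2)"
    using f g by (auto simp: L2_def)
  have quad: "2 * t * b \<le> t\<^sup>2 * (L2_norm \<mu> f)\<^sup>2 + (L2_norm \<mu> g)\<^sup>2" for t
  proof -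
    have "0 \<le> (LINT x|\<mu>. (t * cmod (f x) - cmod (g x))\<^sup>2)"
      by simp
    also have "\<dots> = (LINT x|\<mu>. t\<^sup>2 * (cmod (f x))\<^sup>2 - 2 * t * (cmod (f x) * cmod (g x)) + (cmod (g x))\<^sup>2)"
      by (intro Bochner_Integration.integral_cong) (auto simp: power2_diff power_mult_distrib)
    also have "\<dots> = t\<^sup>2 * (L2_norm \<mu> f)\<^sup>2 - 2 * t * b + (L2_norm \<mu> g)\<^sup>2"
      using int ints by (simp add: L2_norm_power2 b_def)
    finally show ?thesis by simp
  qed
  have "b \<le> L2_norm \<mu> f * L2_norm \<mu> g"
  proof (cases "L2_norm \<mu> f = 0")
    case True
    \<comment> \<open>If \<open>b\<close> were nonzero, this choice of \<open>t\<close> would make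
      \<open>t * b\<close> equal to ||g||^2 + 1, contradicting \<open>quad\<close>, whose quadratic
      term vanishes here.\<close>
    have "b \<le> 0"
      using quad[of "((L2_norm \<mu> g)\<^sup>2 + 1) / b"] True zero_le_power2[of "L2_norm \<mu> g"]
      by (cases "b = 0") auto
    with True show ?thesis by simp
  next
    case False
    with L2_norm_nonneg[of \<mu> f] have "0 < L2_norm \<mu> f" by simp
    \<comment> \<open>The value t = b / ||f||^2 minimizes the quadratic.\<close>
    then have "b\<^sup>2 \<le> (L2_norm \<mu> f * L2_norm \<mu> g)\<^sup>2"
      using quad[of "b / (L2_norm \<mu> f)\<^sup>2"] by (simp add: field_simps power2_eq_square)
    then show ?thesis
      by (rule power2_le_imp_le) (simp add: L2_norm_nonneg)
  qed
  moreover have "cmod (L2_inner \<mu> f g) \<le> b"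
    unfolding L2_inner_def b_def using integral_norm_bound[of \<mu> "\<lambda>x. f x * cnj (g x)"]
    by (simp add: norm_mult)
  ultimately show ?thesis by linarith
qed

text \<open>Expanding one factor of ||f + g||^2 and applying Cauchy-Schwarz against f + g leaves a
  common factor ||f + g|| to cancel.\<close>

lemma L2_norm_triangle:
  assumes f: "f \<in> L2 \<mu>" and g: "g \<in> L2 \<mu>"
  shows "L2_norm \<mu> (\<lambda>x. f x + g x) \<le> L2_norm \<mu> f + L2_norm \<mu> g"
proof -
  let ?h = "\<lambda>x. f x + g x"
  note h = L2_add[OF f g]
  have "(L2_norm \<mu> ?h)\<^sup>2 = Re (L2_inner \<mu> ?h ?h)"
    by (simp add: L2_inner_self)
  also have "\<dots> = Re (L2_inner \<mu> f ?h) + Re (L2_inner \<mu> g ?h)"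
    using L2_inner_lincomb_left[OF f g h, of 1 1] by simp
  also have "\<dots> \<le> L2_norm \<mu> f * L2_norm \<mu> ?h + L2_norm \<mu> g * L2_norm \<mu> ?h"
    using L2_cauchy_schwarz[OF f h] L2_cauchy_schwarz[OF g h]
      complex_Re_le_cmod[of "L2_inner \<mu> f ?h"] complex_Re_le_cmod[of "L2_inner \<mu> g ?h"]
    by linarith
  finally have "L2_norm \<mu> ?h * L2_norm \<mu> ?h \<le> (L2_norm \<mu> f + L2_norm \<mu> g) * L2_norm \<mu> ?h"
    by (simp add: power2_eq_square distrib_right)
  then show ?thesis
    using L2_norm_nonneg[of \<mu> ?h] L2_norm_nonneg[of \<mu> f] L2_norm_nonneg[of \<mu> g]
    by (cases "L2_norm \<mu> ?h = 0") (auto simp: mult_le_cancel_right)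
qed

lemma L2_norm_sum_le:
  assumes "\<And>i. i \<in> I \<Longrightarrow> f i \<in> L2 \<mu>"
  shows "L2_norm \<mu> (\<lambda>x. \<Sum>i\<in>I. f i x) \<le> (\<Sum>i\<in>I. L2_norm \<mu> (f i))"
  using assms
proof (induction I rule: infinite_finite_induct)
  case (insert i I)
  then have "L2_norm \<mu> (\<lambda>x. f i x + (\<Sum>j\<in>I. f j x))
      \<le> L2_norm \<mu> (f i) + L2_norm \<mu> (\<lambda>x. \<Sum>j\<in>I. f j x)"
    by (intro L2_norm_triangle L2_sum) auto
  with insert show ?case by fastforce
qed (auto simp: L2_norm_def)


section \<open>Projection-valued measures\<close>

context
  fixes \<mu> :: "'a measure" and E :: "real set \<Rightarrow> ('a \<Rightarrow> complex) \<Rightarrow> ('a \<Rightarrow> complex)"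
  assumes pvm: "projection_valued_measure \<mu> E"
begin

lemma pvm_L2: "B \<in> sets borel \<Longrightarrow> f \<in> L2 \<mu> \<Longrightarrow> E B f \<in> L2 \<mu>"
  using pvm by (auto simp: projection_valued_measure_def orthogonal_projection_def)

lemma pvm_symmetric:
  "B \<in> sets borel \<Longrightarrow> f \<in> L2 \<mu> \<Longrightarrow> g \<in> L2 \<mu> \<Longrightarrow> L2_inner \<mu> (E B f) g = L2_inner \<mu> f (E B g)"
  using pvm by (auto simp: projection_valued_measure_def orthogonal_projection_def)

lemma pvm_lincomb:
  "B \<in> sets borel \<Longrightarrow> f \<in> L2 \<mu> \<Longrightarrow> g \<in> L2 \<mu> \<Longrightarrow>
    AE x in \<mu>. E B (\<lambda>y. a * f y + b * g y) x = a * E B f x + b * E B g x"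
  using pvm by (auto simp: projection_valued_measure_def orthogonal_projection_def)

lemma pvm_Int:
  "B \<in> sets borel \<Longrightarrow> C \<in> sets borel \<Longrightarrow> f \<in> L2 \<mu> \<Longrightarrow>
    AE x in \<mu>. E (B \<inter> C) f x = E B (E C f) x"
  using pvm by (auto simp: projection_valued_measure_def)

text \<open>Symmetry moves \<open>E C\<close> onto the left argument, where multiplicativity merges
  it with \<open>E B\<close>.\<close>

lemma pvm_inner:
  assumes "B \<in> sets borel" "C \<in> sets borel" "f \<in> L2 \<mu>" "g \<in> L2 \<mu>"
  shows "L2_inner \<mu> (E B f) (E C g) = L2_inner \<mu> (E (B \<inter> C) f) g"
proof -
  have "L2_inner \<mu> (E B f) (E C g) = L2_inner \<mu> (E C (E B f)) g"
    using assms by (simp add: pvm_symmetric pvm_L2)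
  also have "\<dots> = L2_inner \<mu> (E (C \<inter> B) f) g"
    using pvm_Int[of C B f] assms by (intro L2_inner_cong_AE) (auto intro!: pvm_L2 simp: eq_commute)
  finally show ?thesis by (simp add: Int_commute)
qed

text \<open>Taking C = B in \<open>pvm_inner\<close> produces a squared norm, so \<open>Re\<close>
  and \<open>ennreal\<close> in \<open>spectral_measure\<close> discard nothing.\<close>

lemma pvm_inner_self:
  assumes "B \<in> sets borel" "f \<in> L2 \<mu>"
  shows "L2_inner \<mu> (E B f) f = of_real ((L2_norm \<mu> (E B f))\<^sup>2)"
  using pvm_inner[of B B f f] assms by (simp add: L2_inner_self)

text \<open>Countable additivity of \<open>E\<close> is convergence in norm. Pairing the remainder
  with \<open>f\<close> and using Cauchy-Schwarz turns it into convergence of a numerical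
  series.\<close>

lemma pvm_sums:
  fixes B :: "nat \<Rightarrow> real set"
  assumes B: "\<And>i. B i \<in> sets borel" "disjoint_family B" and f: "f \<in> L2 \<mu>"
  shows "(\<lambda>i. (L2_norm \<mu> (E (B i) f))\<^sup>2) sums (L2_norm \<mu> (E (\<Union>i. B i) f))\<^sup>2"
proof -
  let ?U = "\<Union>i. B i"
  let ?d = "\<lambda>n x. E ?U f x - (\<Sum>i<n. E (B i) f x)"
  have U: "?U \<in> sets borel" using B by auto
  have lim: "(\<lambda>n. L2_norm \<mu> (?d n)) \<longlonglongrightarrow> 0"
    using pvm B f unfolding projection_valued_measure_def by blast
  have d: "?d n \<in> L2 \<mu>" for n
    using B U f by (intro L2_diff L2_sum pvm_L2) auto
  have "norm ((L2_norm \<mu> (E ?U f))\<^sup>2 - (\<Sum>i<n. (L2_norm \<mu> (E (B i) f))\<^sup>2))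
      \<le> L2_norm \<mu> (?d n) * L2_norm \<mu> f" for n
  proof -
    have "L2_inner \<mu> (?d n) f = of_real ((L2_norm \<mu> (E ?U f))\<^sup>2 - (\<Sum>i<n. (L2_norm \<mu> (E (B i) f))\<^sup>2))"
      using B U f by (simp add: L2_inner_diff_left L2_inner_sum_left L2_sum pvm_L2 pvm_inner_self)
    with L2_cauchy_schwarz[OF d f, of n] show ?thesis
      by (simp only: norm_of_real real_norm_def)
  qed
  then have "(\<lambda>n. (L2_norm \<mu> (E ?U f))\<^sup>2 - (\<Sum>i<n. (L2_norm \<mu> (E (B i) f))\<^sup>2)) \<longlonglongrightarrow> 0"
    by (intro Lim_null_comparison[OF _ tendsto_mult_left_zero[OF lim]] always_eventually allI)
  then have "(\<lambda>n. (L2_norm \<mu> (E ?U f))\<^sup>2 - ((L2_norm \<mu> (E ?U f))\<^sup>2 - (\<Sum>i<n. (L2_norm \<mu> (E (B i) f))\<^sup>2)))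
      \<longlonglongrightarrow> (L2_norm \<mu> (E ?U f))\<^sup>2 - 0"
    by (intro tendsto_intros)
  then show ?thesis by (simp add: sums_def)
qed

section \<open>Spectral measures of vectors\<close>

lemma space_spectral_measure [simp]: "space (spectral_measure \<mu> E f) = UNIV"
  and sets_spectral_measure [simp, measurable_cong]: "sets (spectral_measure \<mu> E f) = sets borel"
  using sets.sigma_sets_eq[of "borel :: real measure"] by (simp_all add: spectral_measure_def)

text \<open>\<open>measure_of\<close> reproduces a set function only once that is known to be
  positive and countably additive; additivity comes from \<open>pvm_sums\<close>.\<close>

lemma emeasure_spectral_measure:
  assumes f: "f \<in> L2 \<mu>" and C: "C \<in> sets borel"
  shows "emeasure (spectral_measure \<mu> E f) C = ennreal ((L2_norm \<mu> (E C f))\<^sup>2)"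
proof -
  let ?N = "\<lambda>B. ennreal (Re (L2_inner \<mu> (E B f) f))"
  have N: "?N B = ennreal ((L2_norm \<mu> (E B f))\<^sup>2)" if "B \<in> sets borel" for B
    using that f by (simp add: pvm_inner_self)
  have "AE x in \<mu>. E {} f x = 0"
    using pvm f by (auto simp: projection_valued_measure_def)
  then have "L2_inner \<mu> (E {} f) f = L2_inner \<mu> (\<lambda>x. 0) f"
    using f by (intro L2_inner_cong_AE) (auto intro: L2_zero pvm_L2)
  then have "positive (sets borel) ?N"
    by (simp add: positive_def L2_inner_def)
  moreover have "countably_additive (sets borel) ?N"
  proof (rule countably_additiveI)
    fix B :: "nat \<Rightarrow> real set"
    assume B: "range B \<subseteq> sets borel" "disjoint_family B" "(\<Union>i. B i) \<in> sets borel"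
    have "(\<Sum>i. ?N (B i)) = (\<Sum>i. ennreal ((L2_norm \<mu> (E (B i) f))\<^sup>2))"
      using B by (intro suminf_cong N) auto
    also have "\<dots> = ennreal ((L2_norm \<mu> (E (\<Union>i. B i) f))\<^sup>2)"
      using B f by (intro suminf_ennreal_eq pvm_sums) auto
    finally show "(\<Sum>i. ?N (B i)) = ?N (\<Union>i. B i)"
      using N[OF B(3)] by simp
  qed
  ultimately have "emeasure (spectral_measure \<mu> E f) C = ?N C"
    unfolding spectral_measure_def using C sets.sigma_algebra_axioms[of "borel :: real measure"]
    by (intro emeasure_measure_of_sigma) (auto simp: space_borel)
  with N[OF C] show ?thesis by simp
qed

lemma finite_measure_spectral_measure:
  "f \<in> L2 \<mu> \<Longrightarrow> finite_measure (spectral_measure \<mu> E f)"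
  by (rule finite_measureI) (simp add: emeasure_spectral_measure)

text \<open>Polarization in \<open>spectral_integral\<close> involves the spectral measures of f +
  i^k h. For h = E(B)f each of them has a density with respect to the measure of f, namely |1 + c
  1_B|^2.\<close>

lemma spectral_measure_pvm_perturbation:
  assumes f: "f \<in> L2 \<mu>" and B: "B \<in> sets borel"
  shows "spectral_measure \<mu> E (\<lambda>x. f x + c * E B f x) =
    density (spectral_measure \<mu> E f) (\<lambda>t. ennreal (1 + (2 * Re c + (cmod c)\<^sup>2) * indicator B t))"
    (is "?\<nu>' = density ?\<nu> ?w")
proof (rule measure_eqI)
  let ?g = "\<lambda>x. f x + c * E B f x"
  let ?n = "\<lambda>C. (L2_norm \<mu> (E C f))\<^sup>2"
  note EB = pvm_L2[OF B f]
  have g: "?g \<in> L2 \<mu>" using L2_lincomb[OF f EB, of 1 c] by simp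
  fix C assume "C \<in> sets ?\<nu>'"
  then have C: "C \<in> sets borel" by simp
  note EC = pvm_L2[OF C f] and ECB = pvm_L2[OF sets.Int[OF C B] f]
  have AE: "AE x in \<mu>. E C ?g x = 1 * E C f x + c * E (C \<inter> B) f x"
    using pvm_lincomb[OF C f EB, of 1 c] pvm_Int[OF C B f] by eventually_elim simp
  have fg: "L2_inner \<mu> h ?g = L2_inner \<mu> h f + cnj c * L2_inner \<mu> h (E B f)" if "h \<in> L2 \<mu>" for h
    using L2_inner_lincomb_right[OF f EB that, of 1 c] by simp
  have "of_real ((L2_norm \<mu> (E C ?g))\<^sup>2) = L2_inner \<mu> (E C ?g) ?g"
    using pvm_inner_self[OF C g] by simp
  also have "\<dots> = L2_inner \<mu> (\<lambda>x. 1 * E C f x + c * E (C \<inter> B) f x) ?g"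
    by (intro L2_inner_cong_AE g L2_lincomb EC ECB pvm_L2 C AE) auto
  also have "\<dots> = L2_inner \<mu> (E C f) ?g + c * L2_inner \<mu> (E (C \<inter> B) f) ?g"
    using L2_inner_lincomb_left[OF EC ECB g, of 1 c] by simp
  also have "\<dots> = of_real (?n C) + (c + cnj c + c * cnj c) * of_real (?n (C \<inter> B))"
    using B C f pvm_inner[of C B f f] pvm_inner[of "C \<inter> B" B f f]
    by (simp add: fg EC ECB pvm_inner_self Int_assoc algebra_simps)
  also have "\<dots> = of_real (?n C + (2 * Re c + (cmod c)\<^sup>2) * ?n (C \<inter> B))"
    by (simp add: complex_add_cnj flip: complex_norm_square)
  finally have lhs: "(L2_norm \<mu> (E C ?g))\<^sup>2 = ?n C + (2 * Re c + (cmod c)\<^sup>2) * ?n (C \<inter> B)"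
    by (simp only: of_real_eq_iff)
  interpret \<nu>: finite_measure ?\<nu>
    using f by (rule finite_measure_spectral_measure)
  have measure: "measure ?\<nu> A = ?n A" if "A \<in> sets borel" for A
    using emeasure_spectral_measure[OF f that] by (simp add: measure_def)
  \<comment> \<open>The value of the density on \<open>B\<close> is |1 + c|^2.\<close>
  have "0 \<le> 1 + (2 * Re c + (cmod c)\<^sup>2)"
    using zero_le_power2[of "1 + Re c"] zero_le_power2[of "Im c"]
    unfolding cmod_power2 power2_sum one_power2 by linarith
  then have w: "0 \<le> 1 + (2 * Re c + (cmod c)\<^sup>2) * indicator B t" for t
    by (simp add: indicator_def)
  have "emeasure (density ?\<nu> ?w) C = (\<integral>\<^sup>+t. ennreal (indicator C t + (2 * Re c + (cmod c)\<^sup>2) * indicator (C \<inter> B) t) \<partial>?\<nu>)"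
    using B C by (subst emeasure_density) (auto intro!: nn_integral_cong simp: indicator_def)
  \<comment> \<open>The coefficient of the second indicator is negative for c = -1, so the sum
    cannot be split in \<open>ennreal\<close>; it is split as a real integral over a finite
    measure.\<close>
  also have "\<dots> = ennreal (LINT t|?\<nu>. indicator C t + (2 * Re c + (cmod c)\<^sup>2) * indicator (C \<inter> B) t)"
  proof (rule nn_integral_eq_integral)
    show "AE t in ?\<nu>. 0 \<le> indicator C t + (2 * Re c + (cmod c)\<^sup>2) * indicator (C \<inter> B) t"
      using \<open>0 \<le> 1 + (2 * Re c + (cmod c)\<^sup>2)\<close> by (auto simp: indicator_def)
  qed (use B C in \<open>simp add: \<nu>.emeasure_eq_measure\<close>)
  also have "(LINT t|?\<nu>. indicator C t + (2 * Re c + (cmod c)\<^sup>2) * indicator (C \<inter> B) t)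
      = ?n C + (2 * Re c + (cmod c)\<^sup>2) * ?n (C \<inter> B)"
    using B C by (simp add: \<nu>.emeasure_eq_measure measure)
  finally show "emeasure ?\<nu>' C = emeasure (density ?\<nu> ?w) C"
    using lhs emeasure_spectral_measure[OF g C] by simp
qed simp

text \<open>Since E(C)E(B) = E(C \<inter> B), cutting the vector by E(B) restricts its measure to
  \<open>B\<close>.\<close>

lemma spectral_measure_pvm:
  assumes f: "f \<in> L2 \<mu>" and B: "B \<in> sets borel"
  shows "spectral_measure \<mu> E (E B f) = density (spectral_measure \<mu> E f) (indicator B)"
proof (rule measure_eqI)
  fix C assume "C \<in> sets (spectral_measure \<mu> E (E B f))"
  then have C: "C \<in> sets borel" by simp
  have "L2_inner \<mu> (E C (E B f)) (E C (E B f)) = L2_inner \<mu> (E (C \<inter> B) f) (E (C \<inter> B) f)"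
    using pvm_Int[OF C B f] B C f by (intro L2_inner_cong_AE) (auto intro!: pvm_L2 simp: eq_commute)
  then have "(L2_norm \<mu> (E C (E B f)))\<^sup>2 = (L2_norm \<mu> (E (C \<inter> B) f))\<^sup>2"
    by (simp only: L2_inner_self of_real_eq_iff)
  moreover have "emeasure (density (spectral_measure \<mu> E f) (indicator B)) C
      = emeasure (spectral_measure \<mu> E f) (C \<inter> B)"
    using B C by (subst emeasure_density) (auto simp: Int_commute simp flip: indicator_inter_arith)
  ultimately show "emeasure (spectral_measure \<mu> E (E B f)) C
      = emeasure (density (spectral_measure \<mu> E f) (indicator B)) C"
    using B C f by (simp add: emeasure_spectral_measure pvm_L2)
qed simp

section \<open>The spectral integral of the identity function\<close>

lemma pvm_spectral_domain:
  assumes "f \<in> spectral_domain \<mu> E (\<lambda>t. t)" "B \<in> sets borel"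
  shows "E B f \<in> spectral_domain \<mu> E (\<lambda>t. t)"
proof -
  have f: "f \<in> L2 \<mu>" using assms by (simp add: spectral_domain_def)
  have "(\<integral>\<^sup>+ t. ennreal (t\<^sup>2) \<partial>spectral_measure \<mu> E (E B f))
      = (\<integral>\<^sup>+ t. indicator B t * ennreal (t\<^sup>2) \<partial>spectral_measure \<mu> E f)"
    using assms(2) by (simp add: spectral_measure_pvm[OF f] nn_integral_density)
  also have "\<dots> \<le> (\<integral>\<^sup>+ t. ennreal (t\<^sup>2) \<partial>spectral_measure \<mu> E f)"
    by (intro nn_integral_mono) (auto simp: indicator_def)
  also have "\<dots> < \<infinity>" using assms(1) by (simp add: spectral_domain_def)
  finally show ?thesis using f assms(2) by (simp add: spectral_domain_def pvm_L2)
qed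

text \<open>On a finite measure space square integrability suffices, through |t| \<le> 1 + t^2.
  Integrability matters because a Bochner integral defaults to 0 otherwise and linearity would
  fail.\<close>

lemma integrable_spectral_measure:
  assumes "f \<in> spectral_domain \<mu> E (\<lambda>t. t)"
  shows "integrable (spectral_measure \<mu> E f) (\<lambda>t. t)"
proof -
  have f: "f \<in> L2 \<mu>" using assms by (simp add: spectral_domain_def)
  interpret finite_measure "spectral_measure \<mu> E f"
    using f by (rule finite_measure_spectral_measure)
  have "integrable (spectral_measure \<mu> E f) (\<lambda>t. t\<^sup>2)"
    using assms by (intro integrableI_nonneg) (auto simp: spectral_domain_def)
  then have "integrable (spectral_measure \<mu> E f) (\<lambda>t. 1 + t\<^sup>2)"
    by simp
  then show ?thesis
  proof (rule Bochner_Integration.integrable_bound)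
    have "\<bar>t\<bar> \<le> 1 + t\<^sup>2" for t :: real
      using zero_le_power2[of "\<bar>t\<bar> - 1"] zero_le_power2[of t]
      unfolding power2_diff power2_abs one_power2 by linarith
    then show "AE t in spectral_measure \<mu> E f. norm t \<le> norm (1 + t\<^sup>2)"
      by (intro AE_I2) (simp add: add_nonneg_nonneg)
  qed simp
qed

text \<open>The vector E(B)f lies in the domain, so it may serve as the test vector
  \<open>h\<close>; the perturbation formula then reduces the four polarized integrals to
  \<open>I\<close> and \<open>J\<close>.\<close>

lemma L2_inner_pvm_spectral_integral:
  assumes fg: "(f, g) \<in> spectral_integral \<mu> E (\<lambda>t. t)" and B: "B \<in> sets borel"
  shows "L2_inner \<mu> g (E B f) = of_real (LINT t|spectral_measure \<mu> E f. indicator B t * t)"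
proof -
  let ?\<nu> = "spectral_measure \<mu> E f"
  let ?w = "\<lambda>c t. 1 + (2 * Re c + (cmod c)\<^sup>2) * indicator B t :: real"
  define I where "I = (LINT t|?\<nu>. t)"
  define J where "J = (LINT t|?\<nu>. indicator B t * t)"
  have dom: "f \<in> spectral_domain \<mu> E (\<lambda>t. t)"
    using fg by (simp add: spectral_integral_def)
  then have f: "f \<in> L2 \<mu>" by (simp add: spectral_domain_def)
  have int: "integrable ?\<nu> (\<lambda>t. t)" "integrable ?\<nu> (\<lambda>t. indicator B t * t)"
    using integrable_spectral_measure[OF dom] B
      integrable_real_mult_indicator[of B ?\<nu> "\<lambda>t. t"] by (auto simp: mult.commute)
  have pert: "(LINT t|spectral_measure \<mu> E (\<lambda>x. f x + c * E B f x). t)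
      = I + (2 * Re c + (cmod c)\<^sup>2) * J" for c
  proof -
    have "0 \<le> 1 + (2 * Re c + (cmod c)\<^sup>2)"
      using zero_le_power2[of "1 + Re c"] zero_le_power2[of "Im c"]
    unfolding cmod_power2 power2_sum one_power2 by linarith
    then have w: "0 \<le> ?w c t" for t
      by (simp add: indicator_def)
    have "(LINT t|spectral_measure \<mu> E (\<lambda>x. f x + c * E B f x). t) = (LINT t|?\<nu>. ?w c t *\<^sub>R t)"
      unfolding spectral_measure_pvm_perturbation[OF f B] using B w
      by (intro integral_density) auto
    also have "\<dots> = (LINT t|?\<nu>. t + (2 * Re c + (cmod c)\<^sup>2) * (indicator B t * t))"
      by (simp add: algebra_simps)
    also have "\<dots> = I + (2 * Re c + (cmod c)\<^sup>2) * J"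
      using int by (simp add: I_def J_def)
    finally show ?thesis .
  qed
  have "L2_inner \<mu> g (E B f)
      = (\<Sum>k<4. \<i> ^ k * of_real (LINT t|spectral_measure \<mu> E (\<lambda>x. f x + \<i> ^ k * E B f x). t)) / 4"
    using fg pvm_spectral_domain[OF dom B] by (simp add: spectral_integral_def)
  \<comment> \<open>The four powers i^k sum to zero, which removes \<open>I\<close> and the |c|^2
    terms; the sum of i^k 2 Re(i^k) is 4, which cancels the division.\<close>
  also have "\<dots> = of_real J"
    unfolding pert by (simp add: eval_nat_numeral lessThan_Suc algebra_simps)
  finally show ?thesis by (simp add: J_def)
qed

text \<open>On the spectral subspace where \<open>\<bar>t\<bar> \<ge> a\<close> with a fixed sign \<open>\<sigma>\<close> of \<open>t\<close>, the operator is bounded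
  below by \<open>a\<close>: compare \<open>\<langle>g, E(B)f\<rangle> = \<integral>\<^sub>B t d\<langle>Ef, f\<rangle>\<close> with \<open>\<langle>E(B)g, E(B)f\<rangle>\<close>.\<close>

lemma spectral_integral_lower_bound:
  assumes fg: "(f, g) \<in> spectral_integral \<mu> E (\<lambda>t. t)" and B: "B \<in> sets borel"
    and \<sigma>: "\<bar>\<sigma>\<bar> = 1" "\<And>t. t \<in> B \<Longrightarrow> a \<le> \<sigma> * t"
  shows "a * L2_norm \<mu> (E B f) \<le> L2_norm \<mu> (E B g)"
proof -
  let ?\<nu> = "spectral_measure \<mu> E f"
  have dom: "f \<in> spectral_domain \<mu> E (\<lambda>t. t)" and g: "g \<in> L2 \<mu>"
    using fg by (simp_all add: spectral_integral_def)
  then have f: "f \<in> L2 \<mu>" by (simp add: spectral_domain_def)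
  interpret finite_measure ?\<nu>
    using f by (rule finite_measure_spectral_measure)
  have int: "integrable ?\<nu> (\<lambda>t. indicator B t * t)"
    using integrable_spectral_measure[OF dom] B
      integrable_real_mult_indicator[of B ?\<nu> "\<lambda>t. t"] by (auto simp: mult.commute)
  have int': "integrable ?\<nu> (\<lambda>t. indicator B t * a)"
    using B by (simp add: emeasure_eq_measure)
  have "a * (L2_norm \<mu> (E B f))\<^sup>2 = a * measure ?\<nu> B"
    using emeasure_spectral_measure[OF f B] by (simp add: measure_def)
  also have "\<dots> = (LINT t|?\<nu>. indicator B t * a)"
    using B by simp
  also have "\<dots> \<le> (LINT t|?\<nu>. \<sigma> * (indicator B t * t))"
    using int int' \<sigma>(2) by (intro integral_mono) (auto simp: indicator_def)
  also have "\<dots> \<le> \<bar>LINT t|?\<nu>. indicator B t * t\<bar>"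
    using \<sigma>(1) abs_ge_self[of "\<sigma> * (LINT t|?\<nu>. indicator B t * t)"] by (simp add: abs_mult)
  also have "\<dots> = cmod (L2_inner \<mu> g (E B f))"
    by (simp only: L2_inner_pvm_spectral_integral[OF fg B] norm_of_real)
  also have "L2_inner \<mu> g (E B f) = L2_inner \<mu> (E B g) (E B f)"
    using pvm_inner[OF B B g f] pvm_symmetric[OF B g f] by simp
  also have "cmod \<dots> \<le> L2_norm \<mu> (E B g) * L2_norm \<mu> (E B f)"
    using B f g by (intro L2_cauchy_schwarz pvm_L2)
  finally have "(a * L2_norm \<mu> (E B f)) * L2_norm \<mu> (E B f) \<le> L2_norm \<mu> (E B g) * L2_norm \<mu> (E B f)"
    by (simp add: power2_eq_square mult.assoc)
  then show ?thesis
    using L2_norm_nonneg[of \<mu> "E B f"] L2_norm_nonneg[of \<mu> "E B g"]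
    by (cases "L2_norm \<mu> (E B f) = 0") (auto simp: mult_le_cancel_right)
qed

text \<open>Cauchy-Schwarz applied to ||E(B)f||^2 = <E(B)f, f>, with one factor cancelled.\<close>

lemma L2_norm_pvm_le:
  assumes "B \<in> sets borel" "f \<in> L2 \<mu>"
  shows "L2_norm \<mu> (E B f) \<le> L2_norm \<mu> f"
proof -
  have "(L2_norm \<mu> (E B f))\<^sup>2 = cmod (L2_inner \<mu> (E B f) f)"
    by (simp only: pvm_inner_self[OF assms] norm_of_real abs_power2)
  also have "\<dots> \<le> L2_norm \<mu> (E B f) * L2_norm \<mu> f"
    using assms by (intro L2_cauchy_schwarz pvm_L2)
  finally have "L2_norm \<mu> (E B f) * L2_norm \<mu> (E B f) \<le> L2_norm \<mu> f * L2_norm \<mu> (E B f)"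
    by (simp add: power2_eq_square mult.commute)
  then show ?thesis
    using L2_norm_nonneg[of \<mu> "E B f"] L2_norm_nonneg[of \<mu> f]
    by (cases "L2_norm \<mu> (E B f) = 0") (auto simp: mult_le_cancel_right)
qed

text \<open>The lower bound iterates along the chain \<open>u\<close>, since it compares E(B) of
  \<open>u k\<close> with E(B) of \<open>u (Suc k)\<close> for the same \<open>B\<close>. Each half
  line costs one copy of ||u k||^2, whence the factor 2.\<close>

lemma spectral_measure_tail:
  assumes T: "\<And>k. (u k, u (Suc k)) \<in> spectral_integral \<mu> E (\<lambda>t. t)" and a: "0 \<le> a"
  shows "a ^ (2 * k) * measure (spectral_measure \<mu> E (u 0)) {t. a \<le> \<bar>t\<bar>} \<le> 2 * (L2_norm \<mu> (u k))\<^sup>2"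
proof -
  let ?\<nu> = "spectral_measure \<mu> E (u 0)"
  have u: "u k \<in> L2 \<mu>" for k
    using T[of k] by (simp add: spectral_integral_def spectral_domain_def)
  interpret finite_measure ?\<nu>
    using u by (rule finite_measure_spectral_measure)
  have half: "a ^ (2 * k) * measure ?\<nu> B \<le> (L2_norm \<mu> (u k))\<^sup>2"
    if B: "B \<in> sets borel" and \<sigma>: "\<bar>\<sigma>\<bar> = 1" "\<And>t. t \<in> B \<Longrightarrow> a \<le> \<sigma> * t" for B \<sigma>
  proof -
    have "a ^ k * L2_norm \<mu> (E B (u 0)) \<le> L2_norm \<mu> (E B (u k))"
    proof (induction k)
      case (Suc k)
      have "a * (a ^ k * L2_norm \<mu> (E B (u 0))) \<le> a * L2_norm \<mu> (E B (u k))"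
        using Suc a by (rule mult_left_mono)
      also have "\<dots> \<le> L2_norm \<mu> (E B (u (Suc k)))"
        by (rule spectral_integral_lower_bound[OF T B \<sigma>])
      finally show ?case by (simp add: mult.assoc)
    qed simp
    also have "\<dots> \<le> L2_norm \<mu> (u k)"
      using B u by (rule L2_norm_pvm_le)
    finally have "(a ^ k * L2_norm \<mu> (E B (u 0)))\<^sup>2 \<le> (L2_norm \<mu> (u k))\<^sup>2"
      using a by (intro power_mono) (auto simp: L2_norm_nonneg)
    moreover have "measure ?\<nu> B = (L2_norm \<mu> (E B (u 0)))\<^sup>2"
      using emeasure_spectral_measure[OF u B] by (simp add: measure_def)
    ultimately show ?thesis
      by (simp add: power_mult_distrib power_mult mult.commute flip: power_mult)
  qed
  \<comment> \<open>The lower bound needs \<open>t\<close> of constant sign, so the tail is split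
    into two half lines, treated with \<sigma> = 1 and \<sigma> = -1.\<close>
  have "measure ?\<nu> {t. a \<le> \<bar>t\<bar>} \<le> measure ?\<nu> {t. a \<le> t} + measure ?\<nu> {t. a \<le> - t}"
    using measure_Un_le[of "{t. a \<le> t}" ?\<nu> "{t. a \<le> - t}"]
      finite_measure_mono[of "{t. a \<le> \<bar>t\<bar>}" "{t. a \<le> t} \<union> {t. a \<le> - t}"]
    by fastforce
  then have "a ^ (2 * k) * measure ?\<nu> {t. a \<le> \<bar>t\<bar>}
      \<le> a ^ (2 * k) * measure ?\<nu> {t. a \<le> t} + a ^ (2 * k) * measure ?\<nu> {t. a \<le> - t}"
    using a by (simp add: mult_left_mono flip: distrib_left)
  with half[of "{t. a \<le> t}" 1] half[of "{t. a \<le> - t}" "-1"] show ?thesis by simp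
qed

end


section \<open>Smooth functions and vector fields\<close>

text \<open>On an open set derivatives depend only on the values inside it. This makes usable those
  derivative formulas that are known on \<open>S\<close> alone.\<close>

lemma Ck_on_cong:
  assumes "open S"
  shows "Ck_on k S f \<Longrightarrow> (\<And>x. x \<in> S \<Longrightarrow> f x = g x) \<Longrightarrow> Ck_on k S g"
proof (induction k arbitrary: f g)
  case 0
  then show ?case using continuous_on_cong[of S S f g] by simp
next
  case (Suc k)
  have der: "(g has_derivative frechet_derivative f (at x)) (at x)" if "x \<in> S" for x
    using Suc.prems that assms
    by (intro has_derivative_transform_within_open[of f _ x UNIV S g])
       (auto simp: frechet_derivative_works)
  then have "g differentiable (at x)" if "x \<in> S" for x
    using that by (auto simp: differentiable_def)
  moreover have "Ck_on k S (\<lambda>x. frechet_derivative g (at x) v)" for v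
  proof (rule Suc.IH)
    show "Ck_on k S (\<lambda>x. frechet_derivative f (at x) v)"
      using Suc.prems(1) by simp
    show "frechet_derivative f (at x) v = frechet_derivative g (at x) v" if "x \<in> S" for x
      by (simp only: frechet_derivative_at[OF der[OF that]])
  qed
  ultimately show ?case by simp
qed

text \<open>A bounded linear map commutes with differentiation, so the induction passes from
  \<open>f\<close> to its directional derivatives.\<close>

lemma Ck_on_bounded_linear:
  assumes "open S" "bounded_linear h"
  shows "Ck_on k S f \<Longrightarrow> Ck_on k S (\<lambda>x. h (f x))"
proof (induction k arbitrary: f)
  case 0
  then show ?case using bounded_linear.continuous_on[OF assms(2)] by simp
next
  case (Suc k)
  have der: "((\<lambda>x. h (f x)) has_derivative (\<lambda>v. h (frechet_derivative f (at x) v))) (at x)"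
    if "x \<in> S" for x
    using Suc.prems that
    by (intro bounded_linear.has_derivative[OF assms(2)]) (auto simp: frechet_derivative_works)
  then have "(\<lambda>x. h (f x)) differentiable (at x)" if "x \<in> S" for x
    using that by (auto simp: differentiable_def)
  moreover have "Ck_on k S (\<lambda>x. frechet_derivative (\<lambda>x. h (f x)) (at x) v)" for v
  proof (rule Ck_on_cong[OF assms(1)])
    show "Ck_on k S (\<lambda>x. h (frechet_derivative f (at x) v))"
      using Suc by simp
    show "h (frechet_derivative f (at x) v) = frechet_derivative (\<lambda>x. h (f x)) (at x) v"
      if "x \<in> S" for x
      by (simp only: frechet_derivative_at[OF der[OF that], symmetric])
  qed
  ultimately show ?case by simp
qed

lemma Ck_on_add:
  assumes "open S"
  shows "Ck_on k S f \<Longrightarrow> Ck_on k S g \<Longrightarrow> Ck_on k S (\<lambda>x. f x + g x)"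
proof (induction k arbitrary: f g)
  case 0
  then show ?case by (simp add: continuous_on_add)
next
  case (Suc k)
  have der: "((\<lambda>x. f x + g x) has_derivative
      (\<lambda>v. frechet_derivative f (at x) v + frechet_derivative g (at x) v)) (at x)" if "x \<in> S" for x
    using Suc.prems that by (intro has_derivative_add) (auto simp: frechet_derivative_works)
  then have "(\<lambda>x. f x + g x) differentiable (at x)" if "x \<in> S" for x
    using that by (auto simp: differentiable_def)
  moreover have "Ck_on k S (\<lambda>x. frechet_derivative (\<lambda>x. f x + g x) (at x) v)" for v
  proof (rule Ck_on_cong[OF assms])
    show "Ck_on k S (\<lambda>x. frechet_derivative f (at x) v + frechet_derivative g (at x) v)"
      using Suc by simp
    show "frechet_derivative f (at x) v + frechet_derivative g (at x) v
        = frechet_derivative (\<lambda>x. f x + g x) (at x) v" if "x \<in> S" for x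
      by (simp only: frechet_derivative_at[OF der[OF that], symmetric])
  qed
  ultimately show ?case by simp
qed

lemma Ck_on_const: "Ck_on k S (\<lambda>x. c)"
  by (induction k arbitrary: c) auto

lemma C_inf_const: "(\<lambda>x. c) \<in> C_inf \<A>"
  by (auto simp: C_inf_def smooth_on_def comp_def Ck_on_const)

context
  fixes \<A> :: "('a::{t2_space, second_countable_topology}, 'b::euclidean_space) atlas"
  assumes atlas: "smooth_atlas \<A>"
begin

lemma open_chart_image: "(U, c) \<in> \<A> \<Longrightarrow> open (c ` U)"
  using atlas by (auto simp: smooth_atlas_def)

lemma C_inf_bounded_linear: "bounded_linear h \<Longrightarrow> f \<in> C_inf \<A> \<Longrightarrow> (\<lambda>x. h (f x)) \<in> C_inf \<A>"
  unfolding C_inf_def smooth_on_def comp_def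
  using Ck_on_bounded_linear[OF open_chart_image] by blast

lemma C_inf_add: "f \<in> C_inf \<A> \<Longrightarrow> g \<in> C_inf \<A> \<Longrightarrow> (\<lambda>x. f x + g x) \<in> C_inf \<A>"
  unfolding C_inf_def smooth_on_def comp_def
  using Ck_on_add[OF open_chart_image] by blast

lemma C_inf_uminus: "f \<in> C_inf \<A> \<Longrightarrow> (\<lambda>x. - f x) \<in> C_inf \<A>"
  by (rule C_inf_bounded_linear[OF bounded_linear_minus[OF bounded_linear_ident]])

lemma C_inf_sum: "(\<And>i. i \<in> I \<Longrightarrow> f i \<in> C_inf \<A>) \<Longrightarrow> (\<lambda>x. \<Sum>i\<in>I. f i x) \<in> C_inf \<A>"
  by (induction I rule: infinite_finite_induct) (auto intro: C_inf_const C_inf_add)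

lemma C_inf_Re: "f \<in> C_inf \<A> \<Longrightarrow> (\<lambda>x. Re (f x)) \<in> C_inf \<A>"
  and C_inf_Im: "f \<in> C_inf \<A> \<Longrightarrow> (\<lambda>x. Im (f x)) \<in> C_inf \<A>"
  using C_inf_bounded_linear[OF bounded_linear_Re] C_inf_bounded_linear[OF bounded_linear_Im] by auto

text \<open>Written as f + i g, the function is a sum of two bounded linear images of smooth
  functions.\<close>

lemma C_inf_Complex:
  assumes "f \<in> C_inf \<A>" "g \<in> C_inf \<A>"
  shows "(\<lambda>x. Complex (f x) (g x)) \<in> C_inf \<A>"
proof -
  have "(\<lambda>x. complex_of_real (f x) + \<i> * complex_of_real (g x)) \<in> C_inf \<A>"
    using assms
    by (intro C_inf_add C_inf_bounded_linear[OF bounded_linear_of_real]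
        C_inf_bounded_linear[OF bounded_linear_const_mult[OF bounded_linear_of_real]])
  then show ?thesis by (simp add: Complex_eq)
qed

lemma cact_C_inf: "vector_field \<A> Y \<Longrightarrow> f \<in> C_inf \<A> \<Longrightarrow> cact Y f \<in> C_inf \<A>"
  unfolding cact_def by (intro C_inf_Complex) (auto simp: vector_field_def C_inf_Re C_inf_Im)

lemma cact_add:
  "vector_field \<A> Y \<Longrightarrow> f \<in> C_inf \<A> \<Longrightarrow> g \<in> C_inf \<A> \<Longrightarrow>
    cact Y (\<lambda>x. f x + g x) = (\<lambda>x. cact Y f x + cact Y g x)"
  by (auto simp: cact_def vector_field_def C_inf_Re C_inf_Im complex_eq_iff fun_eq_iff)

lemma vector_field_scale:
  "vector_field \<A> Y \<Longrightarrow> f \<in> C_inf \<A> \<Longrightarrow> Y (\<lambda>x. a * f x) = (\<lambda>x. a * Y f x)"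
  by (auto simp: vector_field_def)

lemma cact_uminus:
  "vector_field \<A> Y \<Longrightarrow> f \<in> C_inf \<A> \<Longrightarrow> cact Y (\<lambda>x. - f x) = (\<lambda>x. - cact Y f x)"
  using vector_field_scale[of Y _ "-1"]
  by (auto simp: cact_def C_inf_Re C_inf_Im complex_eq_iff fun_eq_iff)

lemma cact_zero: "vector_field \<A> Y \<Longrightarrow> cact Y (\<lambda>x. 0) = (\<lambda>x. 0)"
  using vector_field_scale[of Y "\<lambda>x. 0" 0] by (auto simp: cact_def C_inf_const complex_eq_iff fun_eq_iff)

section \<open>Words in the vector fields and powers of the sub-Laplacian\<close>

context
  fixes r :: nat and X :: "nat \<Rightarrow> 'a operator"
  assumes X: "\<And>j. j \<in> {1..r} \<Longrightarrow> vector_field \<A> (X j)"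
begin

lemma word_op_C_inf: "set w \<subseteq> {1..r} \<Longrightarrow> f \<in> C_inf \<A> \<Longrightarrow> word_op X w f \<in> C_inf \<A>"
  by (induction w) (auto simp: word_op_def intro!: cact_C_inf X)

lemma word_op_Cons: "word_op X (j # w) f = cact (X j) (word_op X w f)"
  by (simp add: word_op_def)

lemma word_op_append: "word_op X (v @ w) f = word_op X v (word_op X w f)"
  by (simp add: word_op_def)

lemma word_op_uminus:
  "set w \<subseteq> {1..r} \<Longrightarrow> f \<in> C_inf \<A> \<Longrightarrow> word_op X w (\<lambda>x. - f x) = (\<lambda>x. - word_op X w f x)"
  by (induction w) (auto simp: word_op_Cons cact_uminus X word_op_C_inf, auto simp: word_op_def)

lemma word_op_add:
  "set w \<subseteq> {1..r} \<Longrightarrow> f \<in> C_inf \<A> \<Longrightarrow> g \<in> C_inf \<A> \<Longrightarrow>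
    word_op X w (\<lambda>x. f x + g x) = (\<lambda>x. word_op X w f x + word_op X w g x)"
  by (induction w) (auto simp: word_op_Cons cact_add X word_op_C_inf, auto simp: word_op_def)

lemma word_op_zero: "set w \<subseteq> {1..r} \<Longrightarrow> word_op X w (\<lambda>x. 0) = (\<lambda>x. 0)"
  by (induction w) (auto simp: word_op_Cons cact_zero X, auto simp: word_op_def)

lemma word_op_sum:
  assumes "set w \<subseteq> {1..r}" "\<And>i. i \<in> I \<Longrightarrow> f i \<in> C_inf \<A>"
  shows "word_op X w (\<lambda>x. \<Sum>i\<in>I. f i x) = (\<lambda>x. \<Sum>i\<in>I. word_op X w (f i) x)"
  using assms(2)
  by (induction I rule: infinite_finite_induct)
     (auto simp: word_op_zero[OF assms(1)] word_op_add[OF assms(1)] C_inf_sum)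

lemma sub_laplacian_word_op: "sub_laplacian r X f = (\<lambda>x. - (\<Sum>j=1..r. word_op X [j, j] f x))"
  by (simp add: sub_laplacian_def word_op_def)

lemma sub_laplacian_C_inf: "f \<in> C_inf \<A> \<Longrightarrow> sub_laplacian r X f \<in> C_inf \<A>"
  unfolding sub_laplacian_word_op by (intro C_inf_uminus C_inf_sum word_op_C_inf) auto

lemma sub_laplacian_funpow_C_inf: "f \<in> C_inf \<A> \<Longrightarrow> (sub_laplacian r X ^^ k) f \<in> C_inf \<A>"
  by (induction k) (auto intro: sub_laplacian_C_inf)

text \<open>Linearity pulls the sign and the sum out of the word. The sub-Laplacian acts first, so
  its two letters are appended at the end.\<close>

lemma word_op_sub_laplacian:
  assumes "set w \<subseteq> {1..r}" "f \<in> C_inf \<A>"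
  shows "word_op X w (sub_laplacian r X f) = (\<lambda>x. - (\<Sum>j=1..r. word_op X (w @ [j, j]) f x))"
proof -
  have C_inf: "\<And>j. j \<in> {1..r} \<Longrightarrow> word_op X [j, j] f \<in> C_inf \<A>"
    using assms by (intro word_op_C_inf) auto
  let ?g = "\<lambda>j. word_op X [j, j] f"
  have "(\<lambda>x. \<Sum>j=1..r. ?g j x) \<in> C_inf \<A>"
    using C_inf by (rule C_inf_sum)
  then show ?thesis
    using word_op_uminus[OF assms(1), of "\<lambda>x. \<Sum>j=1..r. ?g j x"]
      word_op_sum[OF assms(1), of "{1..r}" ?g] C_inf
    unfolding sub_laplacian_word_op word_op_append by simp
qed

text \<open>Each application of the sub-Laplacian trades one word for \<open>r\<close> words with
  two more letters; \<open>k\<close> applications give r^k words of length 2k.\<close>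

lemma L2_norm_sub_laplacian_funpow:
  assumes f: "f \<in> C_inf \<A>"
    and N: "\<And>w. set w \<subseteq> {1..r} \<Longrightarrow> word_op X w f \<in> L2 \<mu> \<and> L2_norm \<mu> (word_op X w f) \<le> N (length w)"
  shows "(sub_laplacian r X ^^ k) f \<in> L2 \<mu>"
    and "L2_norm \<mu> ((sub_laplacian r X ^^ k) f) \<le> real r ^ k * N (2 * k)"
proof -
  let ?u = "\<lambda>k. (sub_laplacian r X ^^ k) f"
  \<comment> \<open>Generalized over \<open>w\<close>: the step to \<open>Suc k\<close> needs the
    bound for \<open>k\<close> on the longer words \<open>w @ [j, j]\<close>.\<close>
  have *: "word_op X w (?u k) \<in> L2 \<mu> \<and>
      L2_norm \<mu> (word_op X w (?u k)) \<le> real r ^ k * N (length w + 2 * k)"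
    if "set w \<subseteq> {1..r}" for w
    using that
  proof (induction k arbitrary: w)
    case 0
    then show ?case using N by simp
  next
    case (Suc k)
    let ?g = "\<lambda>j. word_op X (w @ [j, j]) (?u k)"
    have eq: "word_op X w (?u (Suc k)) = (\<lambda>x. - (\<Sum>j=1..r. ?g j x))"
      by (simp only: funpow.simps comp_apply
          word_op_sub_laplacian[OF Suc.prems sub_laplacian_funpow_C_inf[OF f]])
    have g: "?g j \<in> L2 \<mu>" "L2_norm \<mu> (?g j) \<le> real r ^ k * N (length w + 2 * Suc k)"
      if "j \<in> {1..r}" for j
      using Suc.IH[of "w @ [j, j]"] Suc.prems that by auto
    have "L2_norm \<mu> (\<lambda>x. \<Sum>j=1..r. ?g j x) \<le> (\<Sum>j=1..r. L2_norm \<mu> (?g j))"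
      using g by (intro L2_norm_sum_le)
    also have "\<dots> \<le> real (card {1..r}) * (real r ^ k * N (length w + 2 * Suc k))"
      using g by (intro sum_bounded_above)
    finally show ?case
      unfolding eq using g by (auto simp: L2_norm_uminus mult.assoc intro!: L2_uminus L2_sum)
  qed
  show "?u k \<in> L2 \<mu>" "L2_norm \<mu> (?u k) \<le> real r ^ k * N (2 * k)"
    using *[of "[]"] by (auto simp: word_op_def)
qed

end

end

text \<open>The quotient is a multinomial coefficient; inductively, a! b! divides (a + b)!.\<close>

lemma prod_fact_le_fact_sum: "(\<Prod>k\<in>I. fact (\<alpha> k) :: real) \<le> fact (\<Sum>k\<in>I. \<alpha> k)"
proof (induction I rule: infinite_finite_induct)
  case (insert i I)
  have "fact (\<alpha> i) * (\<Prod>k\<in>I. fact (\<alpha> k)) \<le> (fact (\<alpha> i) * fact (\<Sum>k\<in>I. \<alpha> k) :: real)"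
    using insert by (intro mult_left_mono) auto
  also have "\<dots> \<le> fact (\<alpha> i + (\<Sum>k\<in>I. \<alpha> k))"
  proof -
    have "fact (\<alpha> i) * fact (\<Sum>k\<in>I. \<alpha> k) \<le> (fact (\<alpha> i + (\<Sum>k\<in>I. \<alpha> k)) :: nat)"
      by (intro dvd_imp_le fact_fact_dvd_fact) simp
    then show ?thesis by (metis of_nat_fact of_nat_le_iff of_nat_mult)
  qed
  finally show ?case using insert by simp
qed auto

text \<open>A word is an admissible ordering for the multi-index of its own letter counts, whose
  total is the length. Bounding \<alpha>! by |\<alpha>|! leaves a bound in terms of the length only,
  as \<open>L2_norm_sub_laplacian_funpow\<close> requires.\<close>

lemma gevrey_class_word_op_bound:
  assumes "\<phi> \<in> gevrey_class \<A> \<mu> r X s" "s \<ge> 0"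
  obtains A C where "A > 0" "C > 0"
    "\<And>w. set w \<subseteq> {1..r} \<Longrightarrow> word_op X w \<phi> \<in> L2 \<mu> \<and>
      L2_norm \<mu> (word_op X w \<phi>) \<le> C * A ^ length w * fact (length w) powr s"
proof -
  from assms obtain A C where AC: "A > 0" "C > 0"
    and *: "\<And>\<alpha> w. w \<in> words r \<alpha> \<Longrightarrow> word_op X w \<phi> \<in> L2 \<mu> \<and> L2_norm \<mu> (word_op X w \<phi>)
          \<le> C * A ^ (\<Sum>k=1..r. \<alpha> k) * (\<Prod>k=1..r. fact (\<alpha> k)) powr s"
    unfolding gevrey_class_def by blast
  have "word_op X w \<phi> \<in> L2 \<mu> \<and>
      L2_norm \<mu> (word_op X w \<phi>) \<le> C * A ^ length w * fact (length w) powr s"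
    if w: "set w \<subseteq> {1..r}" for w
  proof -
    have len: "(\<Sum>k=1..r. count_list w k) = length w"
      using w by (intro sum_count_set) auto
    have "(\<Prod>k=1..r. fact (count_list w k)) powr s \<le> (fact (length w) :: real) powr s"
      using prod_fact_le_fact_sum[of "count_list w" "{1..r}"] assms(2) len
      by (intro powr_mono2 prod_nonneg) auto
    then have "C * A ^ length w * (\<Prod>k=1..r. fact (count_list w k)) powr s
        \<le> C * A ^ length w * fact (length w) powr s"
      using AC by (intro mult_left_mono) auto
    with *[of w "count_list w"] w len show ?thesis by (auto simp: words_def)
  qed
  with AC show ?thesis using that by blast
qed

lemma subset_graph_closure:
  assumes "(f, g) \<in> T" "f \<in> L2 \<mu>" "g \<in> L2 \<mu>"
  shows "(f, g) \<in> graph_closure \<mu> T"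
proof -
  have "L2_norm \<mu> (\<lambda>x. h x - h x) = 0" for h by (simp add: L2_norm_def)
  with assms show ?thesis unfolding graph_closure_def by force
qed


section \<open>Exponential moments from polynomial ones\<close>

text \<open>The sets |t| \<ge> n^(2s) are the sets |t|^(1/(2s)) \<ge> n. Choosing \<open>k\<close>
  in proportion to \<open>n\<close> makes their masses decay exponentially in \<open>n\<close>,
  which beats the growth of the integrand for small \<open>D\<close>.\<close>

lemma exp_moment_finite:
  fixes \<nu> :: "real measure"
  assumes fin: "finite_measure \<nu>" and sets: "sets \<nu> = sets borel"
    and s: "s \<ge> 1"
    and tail: "\<And>a k. 0 \<le> a \<Longrightarrow>
      a ^ (2 * k) * measure \<nu> {t. a \<le> \<bar>t\<bar>} \<le> 2 * (K * R ^ k * fact (2 * k) powr s)\<^sup>2"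
  shows "\<exists>D>0. (\<integral>\<^sup>+ t. ennreal ((exp (D * t powr (1 / (2 * s))))\<^sup>2) \<partial>\<nu>) < \<infinity>"
proof -
  interpret finite_measure \<nu> by (rule fin)
  note [measurable_cong] = sets
  \<comment> \<open>Being at least 1, \<open>Q\<close> satisfies |R| \<le> Q \<le> Q^(2s), so R^k is
    absorbed into a power of the same shape as the factorial term.\<close>
  define Q where "Q = max 1 \<bar>R\<bar>"
  have Q: "Q \<ge> 1" by (simp add: Q_def)
  \<comment> \<open>The factor e pays for rounding \<open>k\<close> down from n / (4Q).\<close>
  define C where "C = 2 * K\<^sup>2 * exp 1"
  have C: "C \<ge> 0" by (simp add: C_def)
  define S where "S n = {t :: real. real n powr (2 * s) \<le> \<bar>t\<bar>}" for n
  have S [measurable]: "S n \<in> sets borel" for n unfolding S_def by measurable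

  text \<open>The tail bound is used with \<open>2k \<approx> n / (2Q)\<close>, which makes \<open>(Q / n)\<^bsup>2k\<^esup> (2k)! \<le> 2\<^bsup>-2k\<^esup>\<close>.\<close>

  have decay: "measure \<nu> (S n) \<le> C * exp (- real n / (4 * Q))" for n
  proof -
    define k where "k = nat \<lfloor>real n / (4 * Q)\<rfloor>"
    have "real k \<le> real n / (4 * Q)"
      using Q unfolding k_def by simp
    then have k_le: "Q * (4 * real k) \<le> real n"
      using Q by (simp add: field_simps)
    have k_ge: "real n / (4 * Q) - 1 \<le> real k"
      using Q unfolding k_def by linarith
    \<comment> \<open>After R^k is replaced by Q^(2sk), dividing the tail bound by n^(4sk) leaves
      exactly 2 K^2 (x^s)^2.\<close>
    define x where "x = (Q ^ (2 * k) * fact (2 * k)) / real n ^ (2 * k)"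
    have x: "0 \<le> x" using Q by (simp add: x_def)
    have "x \<le> (1 / 4) ^ k"
    proof (cases "k = 0")
      case False
      with k_le Q have n: "real n > 0"
        by (smt (verit) mult_pos_pos of_nat_0_less_iff zero_less_iff_neq_zero)
      have "x \<le> (Q ^ (2 * k) * real (2 * k) ^ (2 * k)) / real n ^ (2 * k)"
        unfolding x_def using Q fact_le_power[of "2 * k"]
        by (intro divide_right_mono mult_left_mono) auto
      also have "\<dots> = (Q * real (2 * k) / real n) ^ (2 * k)"
        by (simp add: power_mult_distrib power_divide)
      also have "\<dots> \<le> (1 / 2) ^ (2 * k)"
        using Q n k_le by (intro power_mono) (auto simp: field_simps)
      also have "\<dots> = (1 / 4 :: real) ^ k"
        by (simp add: power_mult power2_eq_square)
      finally show ?thesis .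
    qed (simp add: x_def)
    moreover have "(1 / 4 :: real) ^ k \<le> 1" by (intro power_le_one) auto
    \<comment> \<open>Since 0 \<le> x \<le> 1 and s \<ge> 1, x^s \<le> x.\<close>
    ultimately have "x powr s \<le> (1 / 4) ^ k"
      using x s powr_mono'[of 1 s x] by (simp add: powr_one)
    then have "(x powr s)\<^sup>2 \<le> ((1 / 4) ^ k)\<^sup>2"
      by (intro power_mono) auto
    also have "\<dots> = (1 / 16 :: real) ^ k"
      by (simp add: power_divide flip: power_mult power_mult_distrib)
         (simp add: power_mult mult.commute[of k])
    also have "\<dots> \<le> exp (- 1) ^ k"
    proof (intro power_mono)
      have "exp 1 \<le> (16 :: real)" using exp_le by linarith
      then show "1 / 16 \<le> exp (- 1 :: real)" by (simp add: exp_minus field_simps)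
    qed auto
    also have "\<dots> = exp (- real k)" by (simp flip: exp_of_nat_mult)
    also have "\<dots> \<le> exp (1 - real n / (4 * Q))" using k_ge by simp
    finally have x_bound: "(x powr s)\<^sup>2 \<le> exp 1 * exp (- real n / (4 * Q))"
      by (simp flip: exp_add)
    have "measure \<nu> (S n) \<le> 2 * K\<^sup>2 * (x powr s)\<^sup>2"
    proof (cases "n = 0")
      \<comment> \<open>Here \<open>S 0\<close> is the whole line, x = 1, and the tail bound with a
        = 0, k = 0 bounds the total mass.\<close>
      case True
      then have "k = 0" by (simp add: k_def)
      with tail[of 0 0] True show ?thesis by (simp add: S_def x_def)
    next
      case False
      then have n: "real n > 0" by simp
      have n_pow: "(real n powr (2 * s)) ^ k = (real n ^ (2 * k)) powr s"
        using n by (simp add: powr_powr mult_ac flip: powr_realpow)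
      have "\<bar>R\<bar> \<le> Q powr (2 * s)"
        using Q s powr_mono[of 1 "2 * s" Q] by (simp add: Q_def)
      then have "\<bar>R\<bar> ^ k \<le> (Q powr (2 * s)) ^ k"
        by (intro power_mono) auto
      also have "\<dots> = (Q ^ (2 * k)) powr s"
        using Q by (simp add: powr_powr mult_ac flip: powr_realpow)
      finally have R_pow: "\<bar>R\<bar> ^ k \<le> (Q ^ (2 * k)) powr s" .
      have "(real n powr (2 * s)) ^ (2 * k) * measure \<nu> (S n)
          \<le> 2 * (K * R ^ k * fact (2 * k) powr s)\<^sup>2"
        unfolding S_def by (intro tail) simp
      also have "\<dots> = 2 * K\<^sup>2 * (\<bar>R\<bar> ^ k * fact (2 * k) powr s)\<^sup>2"
        by (simp add: power_mult_distrib power_even_abs flip: power_mult)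
      also have "\<dots> \<le> 2 * K\<^sup>2 * ((Q ^ (2 * k)) powr s * fact (2 * k) powr s)\<^sup>2"
        using R_pow by (intro mult_left_mono power_mono mult_right_mono) auto
      also have "\<dots> = 2 * K\<^sup>2 * (x powr s * (real n ^ (2 * k)) powr s)\<^sup>2"
        using n Q by (simp add: x_def powr_mult powr_divide)
      also have "\<dots> = (real n powr (2 * s)) ^ (2 * k) * (2 * K\<^sup>2 * (x powr s)\<^sup>2)"
        unfolding mult.commute[of 2 k] power_mult n_pow by (simp add: power_mult_distrib mult_ac)
      finally show ?thesis
        using n by (simp add: mult_le_cancel_left_pos)
    qed
    also have "\<dots> \<le> C * exp (- real n / (4 * Q))"
      using mult_left_mono[OF x_bound, of "2 * K\<^sup>2"] by (simp add: C_def mult.assoc)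
    finally show ?thesis .
  qed

  \<comment> \<open>The decay rate 1/(4Q) is then 4D, twice the growth rate 2D of the squared
    exponential; a geometric series of ratio e^(-2D) remains.\<close>
  define D where "D = 1 / (16 * Q)"
  have D: "D > 0" using Q by (simp add: D_def)
  \<comment> \<open>The single term with n the integer part of |t|^(1/(2s)) already dominates the
    integrand.\<close>
  have pointwise: "ennreal ((exp (D * t powr (1 / (2 * s))))\<^sup>2)
      \<le> (\<Sum>n. ennreal (exp (2 * D * (real n + 1))) * indicator (S n) t)" for t
  proof -
    have single: "g n \<le> (\<Sum>n. g n)" for g :: "nat \<Rightarrow> ennreal" and n
      using sum_le_suminf[of g "{n}"] by simp
    define u where "u = t powr (1 / (2 * s))"
    define n where "n = nat \<lfloor>u\<rfloor>"
    have n: "real n \<le> u" "u \<le> real n + 1"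
      unfolding n_def by (simp add: u_def) linarith
    have "real n powr (2 * s) \<le> u powr (2 * s)"
      using n s by (intro powr_mono2) auto
    also have "\<dots> = \<bar>t\<bar>" \<comment> \<open>the real \<open>ln\<close> is even, so \<open>t powr p = \<bar>t\<bar> powr p\<close> for \<open>t < 0\<close> too\<close>
      using s by (cases "t = 0") (auto simp: u_def powr_powr powr_def exp_ln_abs)
    finally have "t \<in> S n" by (simp add: S_def)
    have "(exp (D * u))\<^sup>2 \<le> exp (2 * D * (real n + 1))"
      using n D by (simp add: power2_eq_square flip: exp_add)
    then have "ennreal ((exp (D * u))\<^sup>2) \<le> ennreal (exp (2 * D * (real n + 1))) * indicator (S n) t"
      using \<open>t \<in> S n\<close> by (simp add: ennreal_leI)
    also have "\<dots> \<le> (\<Sum>n. ennreal (exp (2 * D * (real n + 1))) * indicator (S n) t)"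
      by (rule single)
    finally show ?thesis by (simp add: u_def)
  qed
  have "(\<integral>\<^sup>+ t. ennreal ((exp (D * t powr (1 / (2 * s))))\<^sup>2) \<partial>\<nu>)
      \<le> (\<integral>\<^sup>+ t. (\<Sum>n. ennreal (exp (2 * D * (real n + 1))) * indicator (S n) t) \<partial>\<nu>)"
    by (intro nn_integral_mono pointwise)
  also have "\<dots> = (\<Sum>n. ennreal (exp (2 * D * (real n + 1))) * emeasure \<nu> (S n))"
    by (subst nn_integral_suminf) (auto simp: nn_integral_cmult_indicator sets)
  also have "\<dots> \<le> (\<Sum>n. ennreal (C * exp (2 * D) * exp (- 2 * D) ^ n))"
  proof (intro suminf_le summableI)
    fix n
    have "exp (2 * D * (real n + 1)) * measure \<nu> (S n)
        \<le> exp (2 * D * (real n + 1)) * (C * exp (- real n / (4 * Q)))"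
      using decay by (intro mult_left_mono) auto
    also have "- real n / (4 * Q) = - 4 * D * real n"
      using Q by (simp add: D_def field_simps)
    also have "exp (2 * D * (real n + 1)) * (C * exp (- 4 * D * real n))
        = C * exp (2 * D) * exp (- 2 * D) ^ n"
      by (simp add: algebra_simps flip: exp_add exp_of_nat_mult)
    finally show "ennreal (exp (2 * D * (real n + 1))) * emeasure \<nu> (S n)
        \<le> ennreal (C * exp (2 * D) * exp (- 2 * D) ^ n)"
      by (simp add: emeasure_eq_measure ennreal_leI flip: ennreal_mult)
  qed
  also have "\<dots> < \<infinity>"
  proof -
    have "summable (\<lambda>n. C * exp (2 * D) * exp (- 2 * D) ^ n)"
      using D by (intro summable_mult summable_geometric) simp
    then have "(\<Sum>n. ennreal (C * exp (2 * D) * exp (- 2 * D) ^ n)) \<noteq> \<infinity>"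
      using C by (intro ennreal_suminf_neq_top[folded infinity_ennreal_def]) auto
    then show ?thesis by (simp add: less_top)
  qed
  finally show ?thesis using D by blast
qed


section \<open>The sub-Laplacian on Gevrey functions\<close>

theorem theorem4p2p6:
  fixes \<A> :: "('a::{t2_space, second_countable_topology}, 'b::euclidean_space) atlas"
    and \<mu> :: "'a measure"
    and r :: nat
    and X :: "nat \<Rightarrow> 'a operator"
    and s :: real
    and E :: "real set \<Rightarrow> ('a \<Rightarrow> complex) \<Rightarrow> ('a \<Rightarrow> complex)"
  assumes "s \<ge> 1"
    and "smooth_atlas \<A>"
    and "sets \<mu> = sets borel"
    and "hormander_system \<A> r X"
    and "sobolev_embedding \<A> \<mu> r X"
    and "nonneg_operator \<mu> (sub_laplacian_L2 \<A> \<mu> r X)"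
    and "essentially_self_adjoint \<mu> (sub_laplacian_L2 \<A> \<mu> r X)"
    and "spectral_resolution \<mu> (graph_closure \<mu> (sub_laplacian_L2 \<A> \<mu> r X)) E"
  shows "gevrey_class \<A> \<mu> r X s \<subseteq>
    {\<phi> \<in> C_inf \<A>. \<exists>D>0. \<phi> \<in> spectral_domain \<mu> E (\<lambda>t. exp (D * t powr (1 / (2 * s))))}"
proof
  fix \<phi> assume \<phi>: "\<phi> \<in> gevrey_class \<A> \<mu> r X s"
  let ?T = "sub_laplacian_L2 \<A> \<mu> r X"
  let ?u = "\<lambda>k. (sub_laplacian r X ^^ k) \<phi>"
  from \<phi> have smooth: "\<phi> \<in> C_inf \<A>" by (simp add: gevrey_class_def)
  obtain A C where AC: "A > 0" "C > 0"
    and bound: "\<And>w. set w \<subseteq> {1..r} \<Longrightarrow> word_op X w \<phi> \<in> L2 \<mu> \<and>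
      L2_norm \<mu> (word_op X w \<phi>) \<le> C * A ^ length w * fact (length w) powr s"
    using gevrey_class_word_op_bound[OF \<phi>] assms(1) by auto
  have X: "vector_field \<A> (X j)" if "j \<in> {1..r}" for j
    using assms(4) that by (simp add: hormander_system_def)
  \<comment> \<open>The bound \<open>N\<close> is instantiated as N(n) = C A^n (n!)^s.\<close>
  note u = L2_norm_sub_laplacian_funpow[of \<A> r X, OF assms(2) X smooth bound]
  have pvm: "projection_valued_measure \<mu> E"
    and closure: "graph_closure \<mu> ?T = spectral_integral \<mu> E (\<lambda>t. t)"
    using assms(8) by (simp_all add: spectral_resolution_def)
  \<comment> \<open>Every iterate and its image are smooth and square-integrable, so the pair lies
    in the graph of the differential operator even before closure.\<close>
  have graph: "(?u k, ?u (Suc k)) \<in> spectral_integral \<mu> E (\<lambda>t. t)" for k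
  proof -
    have "?u k \<in> C_inf \<A>"
      using sub_laplacian_funpow_C_inf[of \<A> r X, OF assms(2) X smooth] .
    then have "(?u k, ?u (Suc k)) \<in> ?T"
      using u(1)[of k] u(1)[of "Suc k"] by (auto simp: sub_laplacian_L2_def)
    then show ?thesis
      unfolding closure[symmetric] using u(1) by (intro subset_graph_closure)
  qed
  \<comment> \<open>The factors r^k and A^(2k) are collected, so that
    \<open>exp_moment_finite\<close> applies with K = C and R = r A^2.\<close>
  have "a ^ (2 * k) * measure (spectral_measure \<mu> E \<phi>) {t. a \<le> \<bar>t\<bar>}
      \<le> 2 * (C * (real r * A\<^sup>2) ^ k * fact (2 * k) powr s)\<^sup>2" if "0 \<le> a" for a k
  proof -
    have "L2_norm \<mu> (?u k) \<le> C * (real r * A\<^sup>2) ^ k * fact (2 * k) powr s"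
      using u(2)[of k] by (simp add: power_mult_distrib mult_ac flip: power_mult)
    then have "(L2_norm \<mu> (?u k))\<^sup>2 \<le> (C * (real r * A\<^sup>2) ^ k * fact (2 * k) powr s)\<^sup>2"
      by (intro power_mono L2_norm_nonneg)
    with spectral_measure_tail[where u = ?u and k = k, OF pvm graph that] show ?thesis by simp
  qed
  then have "\<exists>D>0. (\<integral>\<^sup>+ t. ennreal ((exp (D * t powr (1 / (2 * s))))\<^sup>2) \<partial>spectral_measure \<mu> E \<phi>) < \<infinity>"
    using u(1)[of 0] assms(1)
    by (intro exp_moment_finite finite_measure_spectral_measure[OF pvm] sets_spectral_measure[OF pvm]) auto
  then show "\<phi> \<in> {\<phi> \<in> C_inf \<A>. \<exists>D>0. \<phi> \<in> spectral_domain \<mu> E (\<lambda>t. exp (D * t powr (1 / (2 * s))))}"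
    using smooth u(1)[of 0] by (simp add: spectral_domain_def)
qed

end
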